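(* Let $g_1,g_2\in\mathrm{Diff}^1(\mathbb{S}^1)$ be, respectively, an irrational rotation and an orientation-preserving diffeomorphism which is not conjugate to a rotation. Then there exists a $C^1$-neighborhood $\mathcal{U}$ of $(g_1,g_2)$ such that the IFS generated by any pair $(f_1,f_2)\in\mathcal{U}$ is forward and backward minimal. Consequently, for every $(f_1,f_2)\in\mathcal{U}$ the following hold: \begin{itemize} \item (minimality of almost every orbital branch) $\mathbb{S}^1=\overline{\mathcal{O}^+_\omega(x)}$ for every $x\in\mathbb{S}^1$ and every $\omega\in\Sigma_2^+$ with dense orbit under the Bernoulli shift map; \item (density of periodic points) the periodic points of $\mathrm{IFS}(f_1,f_2)$ are dense in $\mathbb{S}^1$. Moreover, if $\mathrm{IFS}(f_1,f_2)$ has a hyperbolic attracting (respectively, repelling) periodic point, then it has a dense set of hyperbolic attracting (respectively, repelling) periodic points. \end{itemize}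
   Context: $\mathrm{Diff}^1(\mathbb{S}^1)$ is the set of $C^1$-diffeomorphisms of the circle with the $C^1$-topology; a $C^1$-neighborhood of $(g_1,g_2)$ is a neighborhood in $\mathrm{Diff}^1(\mathbb{S}^1)\times\mathrm{Diff}^1(\mathbb{S}^1)$. An irrational rotation is a rigid rotation of the circle with irrational rotation number. "Conjugate to a rotation" means topologically conjugate to a rigid rotation. $\mathrm{IFS}(f_1,f_2)$ denotes the semigroup generated by $f_1,f_2$ under composition. The orbit of $x$ is $\{h(x): h\in\mathrm{IFS}(f_1,f_2)\}$, and the IFS is minimal if every orbit is dense in $\mathbb{S}^1$. It is forward and backward minimal if both $\mathrm{IFS}(f_1,f_2)$ and $\mathrm{IFS}(f_1^{-1},f_2^{-1})$ are minimal. For $\omega=\omega_1\omega_2\dots\in\Sigma_2^+=\{1,2\}^{\mathbb{N}}$ (product topology), set $f_\omega^n=f_{\omega_n}\circ\dots\circ f_{\omega_1}$ and $\mathcal{O}^+_\omega(x)=\{f^n_\omega(x): n\in\mathbb{N}\}$. The Bernoulli shift map on $\Sigma_2^+$ is $\omega_1\omega_2\omega_3\dots\mapsto\omega_2\omega_3\dots$. A point $q$ is a periodic point of $\mathrm{IFS}(f_1,f_2)$ if $h(q)=q$ for some $h\in\mathrm{IFS}(f_1,f_2)$; it is a hyperbolic attracting (respectively, repelling) periodic point if $h$ can be chosen with $h(q)=q$ and $|Dh(q)|<1$ (respectively, $|Dh(q)|>1$). *)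

theory Defs
  imports "HOL-Analysis.Analysis"
begin

section \<open>Diffeomorphisms of the circle\<close>

text \<open>Circle maps are functions on the complex plane that are \<^const>\<open>undefined\<close> off
  the unit circle, so that two of them are equal iff they agree on the circle.\<close>

abbreviation S1 :: "complex set" where
  "S1 \<equiv> sphere 0 1"

definition C1_circle_map :: "(complex \<Rightarrow> complex) \<Rightarrow> bool" where
  "C1_circle_map f \<longleftrightarrow> f \<in> S1 \<rightarrow>\<^sub>E S1 \<and> (\<lambda>t. f (cis t)) C1_differentiable_on UNIV"

definition circle_inv :: "(complex \<Rightarrow> complex) \<Rightarrow> complex \<Rightarrow> complex" where
  "circle_inv f = restrict (inv_into S1 f) S1"

definition Diff1 :: "(complex \<Rightarrow> complex) set" where
  "Diff1 = {f. bij_betw f S1 S1 \<and> C1_circle_map f \<and> C1_circle_map (circle_inv f)}"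

text \<open>The derivative with respect to arc length: the tangent line at \<open>z\<close> is spanned by
  \<open>\<i> * z\<close>, and the tangent map of \<open>f\<close> at \<open>z\<close> sends \<open>\<i> * z\<close> to \<open>circle_deriv f z\<close> times
  \<open>\<i> * f z\<close>.  The quotient below is real for every differentiable circle map.\<close>

definition circle_deriv :: "(complex \<Rightarrow> complex) \<Rightarrow> complex \<Rightarrow> real" where
  "circle_deriv f z = Re (vector_derivative (\<lambda>t. f (z * cis t)) (at 0) / (\<i> * f z))"

text \<open>The value 0 off \<^const>\<open>Diff1\<close> is never used by the topology; it is there because
  \<^locale>\<open>Metric_space\<close> wants nonnegativity and symmetry for all arguments.\<close>

definition C1_dist :: "(complex \<Rightarrow> complex) \<Rightarrow> (complex \<Rightarrow> complex) \<Rightarrow> real" where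
  "C1_dist f g =
     (if f \<in> Diff1 \<and> g \<in> Diff1
      then (SUP z\<in>S1. dist (f z) (g z)) + (SUP z\<in>S1. \<bar>circle_deriv f z - circle_deriv g z\<bar>)
      else 0)"

definition C1_topology :: "(complex \<Rightarrow> complex) topology" where
  "C1_topology = Metric_space.mtopology Diff1 C1_dist"

definition orientation_preserving :: "(complex \<Rightarrow> complex) \<Rightarrow> bool" where
  "orientation_preserving f \<longleftrightarrow> (\<forall>z\<in>S1. circle_deriv f z > 0)"


section \<open>Rotations\<close>

definition rotation :: "real \<Rightarrow> complex \<Rightarrow> complex" where
  "rotation \<alpha> = (\<lambda>z\<in>S1. cis (2 * pi * \<alpha>) * z)"

definition is_lift :: "(real \<Rightarrow> real) \<Rightarrow> (complex \<Rightarrow> complex) \<Rightarrow> bool" where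
  "is_lift F f \<longleftrightarrow> continuous_on UNIV F \<and> (\<forall>x. F (x + 1) = F x + 1) \<and>
     (\<forall>x. f (cis (2 * pi * x)) = cis (2 * pi * F x))"

text \<open>The rotation number is a class modulo 1; \<open>\<rho>\<close> is a representative of it, one for each
  choice of the lift.\<close>

definition has_rotation_number :: "(complex \<Rightarrow> complex) \<Rightarrow> real \<Rightarrow> bool" where
  "has_rotation_number f \<rho> \<longleftrightarrow>
     (\<exists>F. is_lift F f \<and> (\<forall>x. (\<lambda>n. ((F ^^ n) x - x) / real n) \<longlonglongrightarrow> \<rho>))"

definition irrational_rotation :: "(complex \<Rightarrow> complex) \<Rightarrow> bool" where
  "irrational_rotation f \<longleftrightarrow> f \<in> range rotation \<and> (\<exists>\<rho>. has_rotation_number f \<rho> \<and> \<rho> \<notin> \<rat>)"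

definition conjugate_to_rotation :: "(complex \<Rightarrow> complex) \<Rightarrow> bool" where
  "conjugate_to_rotation f \<longleftrightarrow>
     (\<exists>\<alpha> \<phi> \<psi>. homeomorphism S1 S1 \<phi> \<psi> \<and> (\<forall>z\<in>S1. \<phi> (f z) = rotation \<alpha> (\<phi> z)))"


section \<open>Iterated function systems\<close>

inductive_set IFS :: "(complex \<Rightarrow> complex) \<Rightarrow> (complex \<Rightarrow> complex) \<Rightarrow> (complex \<Rightarrow> complex) set"
  for f1 f2 where
  gen1: "f1 \<in> IFS f1 f2"
| gen2: "f2 \<in> IFS f1 f2"
| comp: "h \<in> IFS f1 f2 \<Longrightarrow> k \<in> IFS f1 f2 \<Longrightarrow> compose S1 h k \<in> IFS f1 f2"

definition IFS_orbit :: "(complex \<Rightarrow> complex) \<Rightarrow> (complex \<Rightarrow> complex) \<Rightarrow> complex \<Rightarrow> complex set" where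
  "IFS_orbit f1 f2 x = {h x | h. h \<in> IFS f1 f2}"

definition dense_in_circle :: "complex set \<Rightarrow> bool" where
  "dense_in_circle A \<longleftrightarrow> A \<subseteq> S1 \<and> closure A = S1"

definition minimal_IFS :: "(complex \<Rightarrow> complex) \<Rightarrow> (complex \<Rightarrow> complex) \<Rightarrow> bool" where
  "minimal_IFS f1 f2 \<longleftrightarrow> (\<forall>x\<in>S1. dense_in_circle (IFS_orbit f1 f2 x))"

definition forward_backward_minimal :: "(complex \<Rightarrow> complex) \<Rightarrow> (complex \<Rightarrow> complex) \<Rightarrow> bool" where
  "forward_backward_minimal f1 f2 \<longleftrightarrow>
     minimal_IFS f1 f2 \<and> minimal_IFS (circle_inv f1) (circle_inv f2)"

definition periodic_points :: "(complex \<Rightarrow> complex) \<Rightarrow> (complex \<Rightarrow> complex) \<Rightarrow> complex set" where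
  "periodic_points f1 f2 = {q\<in>S1. \<exists>h\<in>IFS f1 f2. h q = q}"

definition attracting_periodic_points ::
    "(complex \<Rightarrow> complex) \<Rightarrow> (complex \<Rightarrow> complex) \<Rightarrow> complex set" where
  "attracting_periodic_points f1 f2 =
     {q\<in>S1. \<exists>h\<in>IFS f1 f2. h q = q \<and> \<bar>circle_deriv h q\<bar> < 1}"

definition repelling_periodic_points ::
    "(complex \<Rightarrow> complex) \<Rightarrow> (complex \<Rightarrow> complex) \<Rightarrow> complex set" where
  "repelling_periodic_points f1 f2 =
     {q\<in>S1. \<exists>h\<in>IFS f1 f2. h q = q \<and> \<bar>circle_deriv h q\<bar> > 1}"


section \<open>Symbolic dynamics and orbital branches\<close>

text \<open>A sequence \<open>\<omega>\<^sub>1 \<omega>\<^sub>2 \<dots>\<close> over \<open>{1, 2}\<close> is indexed from 0: \<open>\<omega> n\<close> is its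
  \<open>(n + 1)\<close>-st symbol.\<close>

definition Sigma2_topology :: "(nat \<Rightarrow> nat) topology" where
  "Sigma2_topology = product_topology (\<lambda>_. discrete_topology {1, 2}) UNIV"

definition Sigma2 :: "(nat \<Rightarrow> nat) set" where
  "Sigma2 = topspace Sigma2_topology"

definition shift :: "(nat \<Rightarrow> nat) \<Rightarrow> nat \<Rightarrow> nat" where
  "shift \<omega> = (\<lambda>n. \<omega> (Suc n))"

definition dense_shift_orbit :: "(nat \<Rightarrow> nat) \<Rightarrow> bool" where
  "dense_shift_orbit \<omega> \<longleftrightarrow> Sigma2_topology closure_of (range (\<lambda>n. (shift ^^ n) \<omega>)) = Sigma2"

fun branch :: "(complex \<Rightarrow> complex) \<Rightarrow> (complex \<Rightarrow> complex) \<Rightarrow> (nat \<Rightarrow> nat) \<Rightarrow> nat \<Rightarrow> complex \<Rightarrow> complex" where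
  "branch f1 f2 \<omega> 0 x = x"
| "branch f1 f2 \<omega> (Suc n) x = (if \<omega> n = 1 then f1 else f2) (branch f1 f2 \<omega> n x)"

text \<open>The time index ranges over the positive integers, like the index of \<open>\<omega>\<^sub>1 \<omega>\<^sub>2 \<dots>\<close>.\<close>

definition branch_orbit ::
    "(complex \<Rightarrow> complex) \<Rightarrow> (complex \<Rightarrow> complex) \<Rightarrow> (nat \<Rightarrow> nat) \<Rightarrow> complex \<Rightarrow> complex set" where
  "branch_orbit f1 f2 \<omega> x = {branch f1 f2 \<omega> n x | n. n \<ge> 1}"


section \<open>The definitions behave as intended\<close>

lemma Sigma2_eq: "Sigma2 = {\<omega>. range \<omega> \<subseteq> {1, 2}}"
  by (auto simp: Sigma2_def Sigma2_topology_def PiE_def Pi_def)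

lemma C1_circle_map_deriv_exists:
  assumes "C1_circle_map f"
  obtains D where "continuous_on UNIV D"
    "\<And>t. ((\<lambda>t. f (cis t)) has_vector_derivative D t) (at t)"
    "\<And>t. circle_deriv f (cis t) = Re (D t / (\<i> * f (cis t)))"
proof -
  obtain D where D: "\<And>t. ((\<lambda>t. f (cis t)) has_vector_derivative D t) (at t)"
      "continuous_on UNIV D"
    using assms unfolding C1_circle_map_def C1_differentiable_on_def by blast
  have "circle_deriv f (cis t) = Re (D t / (\<i> * f (cis t)))" for t
  proof -
    have "((\<lambda>s. t + s) has_vector_derivative 1) (at 0)"
      by (auto intro!: derivative_eq_intros)
    then have "(((\<lambda>t. f (cis t)) \<circ> (\<lambda>s. t + s)) has_vector_derivative 1 *\<^sub>R D t) (at 0)"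
      using D(1)[of t] by (intro vector_diff_chain_at) auto
    then have "((\<lambda>s. f (cis t * cis s)) has_vector_derivative D t) (at 0)"
      by (simp add: o_def cis_mult)
    then show ?thesis
      by (simp add: circle_deriv_def vector_derivative_at)
  qed
  with D that show thesis by blast
qed

lemma bounded_circle_deriv:
  assumes "C1_circle_map f"
  shows "bounded (circle_deriv f ` S1)"
proof -
  obtain D where D: "continuous_on UNIV D"
    "\<And>t. ((\<lambda>t. f (cis t)) has_vector_derivative D t) (at t)"
    "\<And>t. circle_deriv f (cis t) = Re (D t / (\<i> * f (cis t)))"
    using C1_circle_map_deriv_exists[OF assms] by blast
  have S1: "f (cis t) \<in> S1" for t
    using assms by (auto simp: C1_circle_map_def PiE_def Pi_def)
  then have nz: "f (cis t) \<noteq> 0" for t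
    by (metis dist_self mem_sphere zero_neq_one)
  have "continuous_on UNIV (\<lambda>t. f (cis t))"
    using D(2) by (meson continuous_at_imp_continuous_on has_vector_derivative_continuous)
  then have "continuous_on UNIV (\<lambda>t. circle_deriv f (cis t))"
    unfolding D(3) using D(1) nz by (intro continuous_intros) auto
  then have "compact ((\<lambda>t. circle_deriv f (cis t)) ` {-pi..pi})"
    by (intro compact_continuous_image) (auto intro: continuous_on_subset)
  moreover have "circle_deriv f ` S1 \<subseteq> (\<lambda>t. circle_deriv f (cis t)) ` {-pi..pi}"
  proof
    fix y assume "y \<in> circle_deriv f ` S1"
    then obtain z where z: "z \<in> S1" "y = circle_deriv f z" by blast
    then have "z = cis (Arg z)"
      using cis_Arg[of z] by (cases "z = 0") (auto simp: sgn_div_norm)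
    moreover have "Arg z \<in> {-pi..pi}"
      using Arg_bounded[of z] by auto
    ultimately show "y \<in> (\<lambda>t. circle_deriv f (cis t)) ` {-pi..pi}"
      using z by (metis (no_types, lifting) imageI)
  qed
  ultimately show ?thesis
    using bounded_subset compact_imp_bounded by blast
qed

lemma Metric_space_C1: "Metric_space Diff1 C1_dist"
proof -
  have b1: "bdd_above ((\<lambda>z. dist (f z) (g z)) ` S1)" if "f \<in> Diff1" "g \<in> Diff1" for f g
  proof (intro bdd_aboveI2)
    fix z :: complex assume "z \<in> S1"
    then have "f z \<in> S1" "g z \<in> S1"
      using that by (auto simp: Diff1_def C1_circle_map_def PiE_def Pi_def)
    then show "dist (f z) (g z) \<le> 2"
      using dist_triangle3[of "f z" "g z" 0] by auto
  qed
  have b2: "bdd_above ((\<lambda>z. \<bar>circle_deriv f z - circle_deriv g z\<bar>) ` S1)"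
    if fg: "f \<in> Diff1" "g \<in> Diff1" for f g
  proof -
    obtain A where A: "\<And>z. z \<in> S1 \<Longrightarrow> \<bar>circle_deriv f z\<bar> \<le> A"
      using bounded_circle_deriv[of f] fg unfolding Diff1_def bounded_iff
      by (metis (no_types, lifting) imageI mem_Collect_eq real_norm_def)
    obtain B where B: "\<And>z. z \<in> S1 \<Longrightarrow> \<bar>circle_deriv g z\<bar> \<le> B"
      using bounded_circle_deriv[of g] fg unfolding Diff1_def bounded_iff
      by (metis (no_types, lifting) imageI mem_Collect_eq real_norm_def)
    show ?thesis
      by (rule bdd_aboveI2[of _ _ "A + B"]) (use A B in fastforce)
  qed
  have ne: "S1 \<noteq> {}" by simp
  have one: "1 \<in> S1" by simp
  have s1: "0 \<le> (SUP z\<in>S1. dist (f z) (g z))" if "f \<in> Diff1" "g \<in> Diff1" for f g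
    using cSUP_upper2[OF b1[OF that] one, of 0] by simp
  have s2: "0 \<le> (SUP z\<in>S1. \<bar>circle_deriv f z - circle_deriv g z\<bar>)"
    if "f \<in> Diff1" "g \<in> Diff1" for f g
    using cSUP_upper2[OF b2[OF that] one, of 0] by simp
  have eq: "f = g" if fg: "f \<in> Diff1" "g \<in> Diff1" and 0: "C1_dist f g = 0" for f g
  proof -
    have "(SUP z\<in>S1. dist (f z) (g z)) = 0"
      using s1[OF fg] s2[OF fg] 0 fg by (simp add: C1_dist_def)
    then have "dist (f z) (g z) \<le> 0" if "z \<in> S1" for z
      using cSUP_upper[OF that b1[OF fg]] by simp
    then have "f z = g z" if "z \<in> S1" for z
      using that by simp
    then show ?thesis
      using fg unfolding Diff1_def C1_circle_map_def by (intro PiE_ext[of f S1 _ g]) auto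
  qed
  show ?thesis
  proof
    fix f g
    show "0 \<le> C1_dist f g"
      using s1 s2 by (auto simp: C1_dist_def)
    show "C1_dist f g = C1_dist g f"
      by (auto simp: C1_dist_def dist_commute abs_minus_commute)
  next
    fix f g assume fg: "f \<in> Diff1" "g \<in> Diff1"
    have "C1_dist f f = 0"
      using ne by (simp add: C1_dist_def)
    then show "C1_dist f g = 0 \<longleftrightarrow> f = g"
      using eq[OF fg] by auto
  next
    fix f g h assume fgh: "f \<in> Diff1" "g \<in> Diff1" "h \<in> Diff1"
    have "(SUP z\<in>S1. dist (f z) (h z)) \<le> (SUP z\<in>S1. dist (f z) (g z)) + (SUP z\<in>S1. dist (g z) (h z))"
    proof (rule cSUP_least[OF ne])
      fix z :: complex assume "z \<in> S1"
      from cSUP_upper[OF this b1[OF fgh(1,2)]] cSUP_upper[OF this b1[OF fgh(2,3)]]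
      show "dist (f z) (h z) \<le> (SUP z\<in>S1. dist (f z) (g z)) + (SUP z\<in>S1. dist (g z) (h z))"
        using dist_triangle[of "f z" "h z" "g z"] by linarith
    qed
    moreover have "(SUP z\<in>S1. \<bar>circle_deriv f z - circle_deriv h z\<bar>) \<le>
        (SUP z\<in>S1. \<bar>circle_deriv f z - circle_deriv g z\<bar>) +
        (SUP z\<in>S1. \<bar>circle_deriv g z - circle_deriv h z\<bar>)"
    proof (rule cSUP_least[OF ne])
      fix z :: complex assume "z \<in> S1"
      from cSUP_upper[OF this b2[OF fgh(1,2)]] cSUP_upper[OF this b2[OF fgh(2,3)]]
      show "\<bar>circle_deriv f z - circle_deriv h z\<bar> \<le>
        (SUP z\<in>S1. \<bar>circle_deriv f z - circle_deriv g z\<bar>) +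
        (SUP z\<in>S1. \<bar>circle_deriv g z - circle_deriv h z\<bar>)"
        by linarith
    qed
    ultimately show "C1_dist f h \<le> C1_dist f g + C1_dist g h"
      using fgh by (simp add: C1_dist_def)
  qed
qed

lemma topspace_C1_topology: "topspace C1_topology = Diff1"
  unfolding C1_topology_def by (rule Metric_space.topspace_mtopology[OF Metric_space_C1])

lemma lift_rotation:
  assumes "is_lift F (rotation \<alpha>)"
  obtains k :: int where "\<And>x. F x = x + \<alpha> + of_int k"
proof -
  define G where "G = (\<lambda>x. F x - x - \<alpha>)"
  have F: "continuous_on UNIV F" "\<And>x. rotation \<alpha> (cis (2 * pi * x)) = cis (2 * pi * F x)"
    using assms by (auto simp: is_lift_def)
  have int: "G x \<in> \<int>" for x
  proof -
    have "cis (2 * pi * (\<alpha> + x)) = cis (2 * pi * F x)"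
      using F(2)[of x] by (simp add: rotation_def cis_mult algebra_simps)
    then have "cis (2 * pi * F x) / cis (2 * pi * (\<alpha> + x)) = 1"
      by simp
    then have "cis (2 * pi * G x) = 1"
      by (simp add: cis_divide G_def algebra_simps)
    then have "cos (2 * pi * G x) = 1"
      by (simp add: complex_eq_iff)
    then obtain n :: int where "2 * pi * G x = of_int n * 2 * pi"
      by (auto simp: cos_one_2pi_int)
    then have "G x = of_int n" by simp
    then show ?thesis by simp
  qed
  have "continuous_on UNIV G"
    unfolding G_def by (intro continuous_intros F)
  then have "G constant_on UNIV"
  proof (rule continuous_discrete_range_constant[OF connected_UNIV])
    fix x :: real
    show "\<exists>e>0. \<forall>y. y \<in> UNIV \<and> G y \<noteq> G x \<longrightarrow> e \<le> norm (G y - G x)"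
    proof (intro exI[of _ 1] conjI allI impI)
      fix y assume "y \<in> UNIV \<and> G y \<noteq> G x"
      moreover have "G y - G x \<in> \<int>"
        using int by (intro Ints_diff) auto
      ultimately show "1 \<le> norm (G y - G x)"
        using Ints_nonzero_abs_ge1[of "G y - G x"] by auto
    qed auto
  qed
  then obtain c where c: "\<And>x. G x = c"
    by (auto simp: constant_on_def)
  with int[of 0] obtain k :: int where "c = of_int k"
    by (auto elim: Ints_cases)
  with c have "F x = x + \<alpha> + of_int k" for x
    using c[of x] by (simp add: G_def algebra_simps)
  with that show thesis by blast
qed

lemma has_rotation_number_rotation:
  "has_rotation_number (rotation \<alpha>) \<rho> \<longleftrightarrow> \<rho> - \<alpha> \<in> \<int>"
proof -
  have iter: "((\<lambda>x. x + c) ^^ n) x = x + real n * c" for c x :: real and n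
    by (induction n) (auto simp: algebra_simps)
  have lim: "(\<lambda>n. (((\<lambda>x. x + c) ^^ n) x - x) / real n) \<longlonglongrightarrow> c" for c x :: real
    unfolding iter
    by (rule tendsto_eventually, rule eventually_mono[OF eventually_gt_at_top[of 0]]) auto
  show ?thesis
  proof
    assume "has_rotation_number (rotation \<alpha>) \<rho>"
    then obtain F where F: "is_lift F (rotation \<alpha>)"
        "\<And>x. (\<lambda>n. ((F ^^ n) x - x) / real n) \<longlonglongrightarrow> \<rho>"
      by (auto simp: has_rotation_number_def)
    from lift_rotation[OF F(1)] obtain k :: int where "\<And>x. F x = x + \<alpha> + of_int k" by blast
    then have "F = (\<lambda>x. x + (\<alpha> + of_int k))" by (auto simp: fun_eq_iff)
    with lim[of "\<alpha> + of_int k" 0] F(2)[of 0] have "\<rho> = \<alpha> + of_int k"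
      using LIMSEQ_unique by blast
    then show "\<rho> - \<alpha> \<in> \<int>" by simp
  next
    assume "\<rho> - \<alpha> \<in> \<int>"
    then obtain k :: int where "\<rho> - \<alpha> = of_int k" by (auto elim: Ints_cases)
    then have k: "\<rho> = \<alpha> + of_int k" by simp
    have "cis (2 * pi * (x + \<rho>)) = cis (2 * pi * \<alpha>) * cis (2 * pi * x)" for x
    proof -
      have "2 * pi * (x + \<rho>) = (2 * pi * \<alpha> + 2 * pi * x) + 2 * pi * of_int k"
        by (simp add: k algebra_simps)
      then show ?thesis
        by (simp only: cis_mult[symmetric]) (simp add: cis_multiple_2pi)
    qed
    then have "is_lift (\<lambda>x. x + \<rho>) (rotation \<alpha>)"
      by (auto simp: is_lift_def rotation_def intro!: continuous_intros)
    with lim[of \<rho>] show "has_rotation_number (rotation \<alpha>) \<rho>"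
      unfolding has_rotation_number_def by blast
  qed
qed

lemma irrational_rotation_iff: "irrational_rotation f \<longleftrightarrow> (\<exists>\<alpha>. \<alpha> \<notin> \<rat> \<and> f = rotation \<alpha>)"
proof
  assume "irrational_rotation f"
  then obtain \<alpha> \<rho> where *: "f = rotation \<alpha>" "\<rho> - \<alpha> \<in> \<int>" "\<rho> \<notin> \<rat>"
    by (auto simp: irrational_rotation_def has_rotation_number_rotation)
  have "\<alpha> \<notin> \<rat>"
  proof
    assume "\<alpha> \<in> \<rat>"
    then have "(\<rho> - \<alpha>) + \<alpha> \<in> \<rat>"
      using *(2) Ints_subset_Rats by (intro Rats_add) auto
    with *(3) show False by simp
  qed
  with * show "\<exists>\<alpha>. \<alpha> \<notin> \<rat> \<and> f = rotation \<alpha>" by blast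
next
  assume "\<exists>\<alpha>. \<alpha> \<notin> \<rat> \<and> f = rotation \<alpha>"
  then show "irrational_rotation f"
    unfolding irrational_rotation_def
    by (metis Ints_0 diff_self has_rotation_number_rotation rangeI)
qed

end

theory Submission
  imports Defs
begin

text \<open>
  Write \<open>R\<close> for the irrational rotation \<open>g1\<close> and \<open>g\<close> for \<open>g2\<close>.  As \<open>g\<close> is not
  conjugate to a rotation, its derivative is not constant.  A lift of \<open>g\<close> gains exactly \<open>2\<pi>\<close> over a
  period, so the derivative has mean value 1; hence it takes values below 1 and values above 1
  (\<open>not_conjugate_imp_both_sides\<close>).

  Minimality.  Near a point \<open>p\<close> with \<open>g' p < 1\<close> the map \<open>g\<close> contracts.  Finitely many powers of
  \<open>R\<close> carry the image of a ball around \<open>p\<close> over the whole circle without distorting it.  Hence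
  every point \<open>y\<close> is the image of some \<open>u\<close> under a word \<open>R\<^sup>n \<circ> g\<close> that contracts the ball of a fixed
  radius \<open>r\<close> around \<open>u\<close>, and every orbit is \<open>r / 2\<close>-dense.  Only finitely many words occur, so both
  facts survive small \<open>C\<^sup>1\<close>-perturbations; they are recorded in the locale \<open>contracting_pair\<close>.
  Iterating the first fact gives, for each \<open>y\<close>, words that squeeze a ball of radius \<open>r\<close> into an
  arbitrarily small neighbourhood of \<open>y\<close>; together with the second fact this is minimality.  The
  inverse maps are treated in the same way, with a point where \<open>g' > 1\<close> in place of \<open>p\<close>
  (\<open>forward_contracting\<close>, \<open>backward_contracting\<close>).

  Periodic points.  Moving a small ball around \<open>y\<close> into the ball that gets squeezed to \<open>y\<close> produces
  a word that maps a ball around \<open>y\<close> into itself as a contraction.  Its fixed point is attracting.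
  So attracting periodic points are dense, and applied to the inverses the argument gives a dense
  set of repelling ones.

  Branches.  Let \<open>U\<close> be an open arc.  It suffices to find one finite word along which every point
  of the circle visits \<open>U\<close>, because a sequence with dense shift orbit contains every word;
  \<open>common_visiting_word\<close> provides it, as follows.  There is a measure of full support that is
  stationary for the inverse maps: the measure of an arc is the average of the measures of its two
  images.  Suppose that no word makes the whole circle visit \<open>U\<close>, and consider an arc \<open>I\<close> of least
  measure among the arcs that no word makes visit \<open>U\<close> entirely.  Images of such arcs are again such
  arcs, so by stationarity every image of \<open>I\<close> has the same measure as \<open>I\<close>.  Forward minimality gives
  a word that takes a neighbourhood of an endpoint of \<open>I\<close> into \<open>U\<close>; what is left of \<open>I\<close> is then
  mapped to a strictly smaller arc that still cannot be made to visit \<open>U\<close>, a contradiction.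
\<close>

section \<open>Words that make every point visit an open set\<close>

lemma translation_periodic_int:
  fixes f :: "real \<Rightarrow> real" and n :: int
  assumes "\<And>x. f (x + p) = f x + p"
  shows "f (x + of_int n * p) = f x + of_int n * p"
proof (induction n rule: int_induct[where k = 0])
  case (step1 i)
  show ?case using assms[of "x + of_int i * p"] step1 by (simp add: algebra_simps)
next
  case (step2 i)
  show ?case using assms[of "x + of_int (i - 1) * p"] step2 by (simp add: algebra_simps)
qed simp

lemma translation_invariant_set_int:
  fixes V :: "real set" and n :: int
  assumes "\<And>t. t + p \<in> V \<longleftrightarrow> t \<in> V"
  shows "t + of_int n * p \<in> V \<longleftrightarrow> t \<in> V"
proof (induction n rule: int_induct[where k = 0])
  case (step1 i)
  then show ?case using assms[of "t + of_int i * p"] by (simp add: algebra_simps)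
next
  case (step2 i)
  then show ?case using assms[of "t + of_int (i - 1) * p"] by (simp add: algebra_simps)
qed simp

lemma between_multiples_of_2pi:
  fixes x :: real
  obtains n :: int where "of_int n * (2 * pi) \<le> x" "x \<le> of_int (n + 1) * (2 * pi)"
proof -
  define n where "n = \<lfloor>x / (2 * pi)\<rfloor>"
  have "of_int n \<le> x / (2 * pi)" "x / (2 * pi) < of_int n + 1"
    unfolding n_def by linarith+
  then show thesis
    by (intro that[of n]) (simp_all add: field_simps)
qed

lemma degree_one_near_identity:
  fixes f :: "real \<Rightarrow> real"
  assumes "mono f" and per: "\<And>x. f (x + 2 * pi) = f x + 2 * pi" and "f 0 = 0"
  shows "\<bar>f x - x\<bar> \<le> 2 * pi"
proof -
  obtain n :: int where x: "of_int n * (2 * pi) \<le> x" "x \<le> of_int (n + 1) * (2 * pi)"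
    by (rule between_multiples_of_2pi)
  have "f (of_int m * (2 * pi)) = of_int m * (2 * pi)" for m :: int
    using translation_periodic_int[of f "2 * pi" 0 m] per \<open>f 0 = 0\<close> by simp
  then have "of_int n * (2 * pi) \<le> f x" "f x \<le> of_int (n + 1) * (2 * pi)"
    using monoD[OF \<open>mono f\<close> x(1)] monoD[OF \<open>mono f\<close> x(2)] by metis+
  with x show ?thesis by (simp add: algebra_simps)
qed

text \<open>Lifts of two orientation-preserving circle homeomorphisms.  Indexing the maps by natural
  numbers lets \<open>fold F w\<close> be the action of a word \<open>w\<close>, first letter first; only the letters 1 and 2
  occur in the words below.\<close>

locale lifted_pair =
  fixes F :: "nat \<Rightarrow> real \<Rightarrow> real"
  assumes strict_mono_F: "strict_mono (F i)"
    and continuous_F: "continuous_on UNIV (F i)"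
    and periodic_F: "F i (x + 2 * pi) = F i x + 2 * pi"
begin

lemma mono_F: "x \<le> y \<Longrightarrow> F i x \<le> F i y"
  using strict_mono_F[of i] by (simp add: strict_mono_less_eq)

lemma fold_strict_mono: "x < y \<Longrightarrow> fold F w x < fold F w y"
  using strict_mono_F by (induction w arbitrary: x y) (auto simp: strict_mono_def)

lemma fold_mono: "x \<le> y \<Longrightarrow> fold F w x \<le> fold F w y"
  using fold_strict_mono[of x y w] by (cases "x = y") auto

lemma fold_continuous: "continuous_on UNIV (fold F w)"
proof (induction w)
  case (Cons i w)
  show ?case
    using continuous_on_compose[OF continuous_F[of i] continuous_on_subset[OF Cons subset_UNIV]]
    by (simp add: o_def)
qed (simp add: id_def)

lemma fold_periodic: "fold F w (x + of_int n * (2 * pi)) = fold F w x + of_int n * (2 * pi)"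
proof (rule translation_periodic_int)
  show "fold F w (x + 2 * pi) = fold F w x + 2 * pi" for x
    by (induction w arbitrary: x) (auto simp: periodic_F)
qed

text \<open>The function \<open>\<Phi>\<close> is the distribution function, on the universal cover, of a measure that is
  stationary for the inverse maps.  As in the Krylov--Bogolyubov argument it is a cluster point of
  Cesaro averages, here of the iterates of the averaging operator \<open>T\<close> applied to the identity.
  Passing to a cluster point for pointwise convergence at every real number keeps the equation
  exact everywhere, even at points where \<open>\<Phi>\<close> might jump; the price is that the product space is not
  metrizable, so the limit is taken along a filter and not along a subsequence.\<close>

lemma stationary_cdf_exists:
  obtains \<Phi> \<kappa> where "mono \<Phi>" "\<And>x. \<Phi> (x + 2 * pi) = \<Phi> x + 2 * pi"
    "\<And>x. \<Phi> (F 1 x) + \<Phi> (F 2 x) = 2 * \<Phi> x + \<kappa>"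
proof -
  \<comment> \<open>Subtracting the value at 0 keeps the iterates in a compact set of functions.\<close>
  define T :: "(real \<Rightarrow> real) \<Rightarrow> real \<Rightarrow> real" where
    "T = (\<lambda>\<Phi> x. (\<Phi> (F 1 x) + \<Phi> (F 2 x) - \<Phi> (F 1 0) - \<Phi> (F 2 0)) / 2)"
  have T_apply: "T \<Phi> x = (\<Phi> (F 1 x) + \<Phi> (F 2 x) - \<Phi> (F 1 0) - \<Phi> (F 2 0)) / 2" for \<Phi> x
    by (simp add: T_def)
  define good where
    "good = (\<lambda>\<Phi>::real \<Rightarrow> real. mono \<Phi> \<and> (\<forall>x. \<Phi> (x + 2 * pi) = \<Phi> x + 2 * pi) \<and> \<Phi> 0 = 0)"
  define A where "A = (\<lambda>n x. (\<Sum>k\<le>n. (T ^^ k) id x) / real (Suc n))"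
  have good_T: "good (T \<Phi>)" if "good \<Phi>" for \<Phi>
  proof -
    have "mono \<Phi>" "\<And>x. \<Phi> (x + 2 * pi) = \<Phi> x + 2 * pi"
      using that by (auto simp: good_def)
    moreover have "\<Phi> (F i x) \<le> \<Phi> (F i y)" if "x \<le> y" for i x y
      using monoD[OF \<open>mono \<Phi>\<close> mono_F[OF that]] .
    ultimately show ?thesis
      by (auto simp: good_def T_def periodic_F intro!: monoI add_mono)
  qed
  have good_iter: "good ((T ^^ k) id)" for k
    by (induction k) (auto simp: good_T, auto simp: good_def mono_def)
  have good_A: "good (A n)" for n
  proof -
    have "mono (A n)"
      unfolding A_def using good_iter
      by (auto simp: good_def mono_def intro!: divide_right_mono sum_mono)
    moreover have "A n (x + 2 * pi) = A n x + 2 * pi" for x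
      using good_iter by (simp add: A_def good_def sum.distrib add_divide_distrib)
    moreover have "A n 0 = 0"
      using good_iter by (simp add: A_def good_def)
    ultimately show ?thesis by (simp add: good_def)
  qed
  have near: "\<bar>\<Phi> x - x\<bar> \<le> 2 * pi" if "good \<Phi>" for \<Phi> x
    using that degree_one_near_identity[of \<Phi> x] by (auto simp: good_def)
  have T_A: "T (A n) x = (\<Sum>k\<le>n. (T ^^ Suc k) id x) / real (Suc n)" for n x
  proof -
    have iter: "(T ^^ Suc k) id x = ((T ^^ k) id (F 1 x) + (T ^^ k) id (F 2 x) -
        (T ^^ k) id (F 1 0) - (T ^^ k) id (F 2 0)) / 2" for k
      unfolding funpow.simps o_apply by (rule T_apply)
    show ?thesis
      unfolding iter T_apply[of "A n" x]
      by (simp add: A_def sum.distrib sum_subtractf diff_divide_distrib add_divide_distrib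
          sum_divide_distrib mult.commute)
  qed
  have almost_fixed: "\<bar>T (A n) x - A n x\<bar> \<le> 2 * pi / real (Suc n)" for n x
  proof -
    have "T (A n) x - A n x = (\<Sum>k\<le>n. (T ^^ Suc k) id x - (T ^^ k) id x) / real (Suc n)"
      unfolding T_A by (simp add: A_def sum_subtractf diff_divide_distrib del: funpow.simps)
    also have "(\<Sum>k\<le>n. (T ^^ Suc k) id x - (T ^^ k) id x) = (T ^^ Suc n) id x - x"
      using sum_telescope[of "\<lambda>k. - (T ^^ k) id x" n] by simp
    finally show ?thesis
      using near[OF good_iter[of "Suc n"], of x] by (simp add: divide_right_mono del: of_nat_Suc)
  qed
  \<comment> \<open>Tychonoff supplies a pointwise cluster point of the averages.\<close>
  define K :: "(real \<Rightarrow> real) set" where "K = PiE UNIV (\<lambda>x. {x - 2 * pi .. x + 2 * pi})"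
  have "compact K"
    unfolding K_def using compactin_PiE[of "\<lambda>_. euclidean" UNIV "\<lambda>x::real. {x - 2 * pi .. x + 2 * pi}"]
    by (simp add: euclidean_product_topology compactin_euclidean_iff)
  moreover have "A n \<in> K" for n
    using near[OF good_A[of n]] by (auto simp: K_def abs_le_iff algebra_simps)
  then have "eventually (\<lambda>\<Phi>. \<Phi> \<in> K) (filtermap A sequentially)"
    by (simp add: eventually_filtermap)
  ultimately obtain \<Phi> where cluster: "inf (nhds \<Phi>) (filtermap A sequentially) \<noteq> bot"
    unfolding compact_filter by (metis filtermap_bot_iff sequentially_bot)
  define G where "G = inf (nhds \<Phi>) (filtermap A sequentially)"
  have G: "G \<noteq> bot" "G \<le> nhds \<Phi>" "G \<le> filtermap A sequentially"
    using cluster by (auto simp: G_def)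
  have coord: "((\<lambda>\<Psi>. \<Psi> x) \<longlongrightarrow> \<Phi> x) G" for x
  proof -
    have "((\<lambda>\<Psi>. \<Psi> x) \<longlongrightarrow> \<Phi> x) (nhds \<Phi>)"
    proof (rule topological_tendstoI)
      fix V :: "real set" assume "open V" "\<Phi> x \<in> V"
      then show "eventually (\<lambda>\<Psi>. \<Psi> x \<in> V) (nhds \<Phi>)"
        using open_vimage[OF \<open>open V\<close> continuous_on_product_coordinates[of x]]
        by (auto simp: eventually_nhds)
    qed
    then show ?thesis using G(2) filterlim_mono by blast
  qed
  have ev: "eventually P G" if "\<And>n. P (A n)" for P
    using G(3) that by (auto simp: le_filter_def eventually_filtermap)
  have "mono \<Phi>"
  proof (rule monoI)
    fix x y :: real assume "x \<le> y"
    show "\<Phi> x \<le> \<Phi> y"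
    proof (rule tendsto_le[OF G(1) coord coord])
      show "eventually (\<lambda>\<Psi>. \<Psi> x \<le> \<Psi> y) G"
        using good_A \<open>x \<le> y\<close> by (intro ev) (auto simp: good_def mono_def)
    qed
  qed
  moreover have "\<Phi> (x + 2 * pi) = \<Phi> x + 2 * pi" for x
  proof (rule tendsto_unique[OF G(1) coord])
    show "((\<lambda>\<Psi>. \<Psi> (x + 2 * pi)) \<longlongrightarrow> \<Phi> x + 2 * pi) G"
      using tendsto_add[OF coord[of x] tendsto_const[of "2 * pi"]]
      by (rule Lim_transform_eventually) (use good_A in \<open>auto simp: good_def intro!: ev\<close>)
  qed
  moreover have fixed: "T \<Phi> x - \<Phi> x = 0" for x
  proof (rule tendsto_unique[OF G(1)])
    show "((\<lambda>\<Psi>. T \<Psi> x - \<Psi> x) \<longlongrightarrow> T \<Phi> x - \<Phi> x) G"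
      unfolding T_def by (intro tendsto_intros coord) auto
    have "(\<lambda>n. 2 * pi / real (Suc n)) \<longlonglongrightarrow> 0"
      using LIMSEQ_Suc[OF tendsto_divide_0[OF tendsto_const filterlim_real_at_infinity_sequentially]] .
    then have "(\<lambda>n. T (A n) x - A n x) \<longlonglongrightarrow> 0"
      by (rule Lim_null_comparison[rotated]) (use almost_fixed in auto)
    then have "((\<lambda>\<Psi>. T \<Psi> x - \<Psi> x) \<longlongrightarrow> 0) (filtermap A sequentially)"
      by (simp add: filterlim_filtermap)
    then show "((\<lambda>\<Psi>. T \<Psi> x - \<Psi> x) \<longlongrightarrow> 0) G"
      using G(3) filterlim_mono by blast
  qed
  have "\<Phi> (F 1 x) + \<Phi> (F 2 x) = 2 * \<Phi> x + (\<Phi> (F 1 0) + \<Phi> (F 2 0))" for x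
    using fixed[of x] by (simp add: T_def field_simps)
  ultimately show thesis using that by blast
qed


lemma stationary_gap:
  fixes \<Phi> :: "real \<Rightarrow> real"
  assumes "mono \<Phi>" and stat: "\<And>x. \<Phi> (F 1 x) + \<Phi> (F 2 x) = 2 * \<Phi> x + \<kappa>"
    and "i \<in> {1, 2}" "x \<le> y"
  shows "\<Phi> (F i y) - \<Phi> (F i x) \<le> 2 * (\<Phi> y - \<Phi> x)"
proof -
  have "\<Phi> (F j x) \<le> \<Phi> (F j y)" for j
    using monoD[OF \<open>mono \<Phi>\<close> mono_F[OF \<open>x \<le> y\<close>]] .
  from this[of 1] this[of 2] show ?thesis
    using stat[of x] stat[of y] \<open>i \<in> {1, 2}\<close> by auto
qed

text \<open>Full support.  If \<open>\<Phi>\<close> is constant on an interval, then by stationarity it is constant on the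
  images of that interval.  So the points near which \<open>\<Phi>\<close> is constant form a forward invariant open
  set, and under backward minimality such a set is empty or everything.  It cannot be everything,
  as \<open>\<Phi>\<close> would be constant.\<close>

lemma stationary_strict_mono:
  fixes \<Phi> :: "real \<Rightarrow> real"
  assumes mono: "mono \<Phi>" and per: "\<And>x. \<Phi> (x + 2 * pi) = \<Phi> x + 2 * pi"
    and stat: "\<And>x. \<Phi> (F 1 x) + \<Phi> (F 2 x) = 2 * \<Phi> x + \<kappa>"
    and backward: "\<And>V x. \<lbrakk>open V; V \<noteq> {}; \<And>t. t + 2 * pi \<in> V \<longleftrightarrow> t \<in> V\<rbrakk> \<Longrightarrow>
      \<exists>w t. set w \<subseteq> {1, 2} \<and> t \<in> V \<and> fold F w t = x"
  shows "strict_mono \<Phi>"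
proof (rule ccontr)
  define Z where "Z = {x. \<exists>a b. a < x \<and> x < b \<and> \<Phi> a = \<Phi> b}"
  assume "\<not> strict_mono \<Phi>"
  then obtain a b where "a < b" "\<Phi> b \<le> \<Phi> a"
    by (auto simp: strict_mono_def not_less)
  then have "\<Phi> a = \<Phi> b"
    using monoD[OF mono, of a b] by simp
  then have "(a + b) / 2 \<in> Z"
    unfolding Z_def using \<open>a < b\<close> by (intro CollectI exI[of _ a] exI[of _ b]) auto
  moreover have "open Z"
  proof -
    have "Z = (\<Union>(a, b) \<in> {(a, b). \<Phi> a = \<Phi> b}. {a<..<b})"
      unfolding Z_def by (auto, blast)
    then show ?thesis by (auto intro!: open_UN)
  qed
  moreover have "t + 2 * pi \<in> Z \<longleftrightarrow> t \<in> Z" for t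
  proof
    assume "t + 2 * pi \<in> Z"
    then obtain a b where ab: "a < t + 2 * pi" "t + 2 * pi < b" "\<Phi> a = \<Phi> b"
      by (auto simp: Z_def)
    then have "\<Phi> (a - 2 * pi) = \<Phi> (b - 2 * pi)"
      using per[of "a - 2 * pi"] per[of "b - 2 * pi"] by simp
    with ab show "t \<in> Z"
      unfolding Z_def by (intro CollectI exI[of _ "a - 2 * pi"] exI[of _ "b - 2 * pi"]) auto
  next
    assume "t \<in> Z"
    then obtain a b where ab: "a < t" "t < b" "\<Phi> a = \<Phi> b"
      by (auto simp: Z_def)
    then have "\<Phi> (a + 2 * pi) = \<Phi> (b + 2 * pi)"
      using per[of a] per[of b] by simp
    with ab show "t + 2 * pi \<in> Z"
      unfolding Z_def by (intro CollectI exI[of _ "a + 2 * pi"] exI[of _ "b + 2 * pi"]) auto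
  qed
  moreover have F_Z: "F i t \<in> Z" if "i \<in> {1, 2}" "t \<in> Z" for i t
  proof -
    obtain a b where ab: "a < t" "t < b" "\<Phi> a = \<Phi> b"
      using \<open>t \<in> Z\<close> by (auto simp: Z_def)
    then have "F i a < F i t" "F i t < F i b"
      using strict_mono_F[of i] by (auto simp: strict_mono_def)
    moreover have "\<Phi> (F i b) - \<Phi> (F i a) \<le> 2 * (\<Phi> b - \<Phi> a)"
      using ab by (intro stationary_gap[OF mono stat that(1)]) simp
    then have "\<Phi> (F i a) = \<Phi> (F i b)"
      using monoD[OF mono, of "F i a" "F i b"] mono_F[of a b i] ab by simp
    ultimately show ?thesis by (auto simp: Z_def)
  qed
  then have fold_Z: "fold F w t \<in> Z" if "set w \<subseteq> {1, 2}" "t \<in> Z" for w t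
    using that by (induction w arbitrary: t) auto
  ultimately have "x \<in> Z" for x
    using backward[of Z x] by blast
  then have "(\<Phi> has_real_derivative 0) (at x)" for x
  proof -
    obtain a b where ab: "a < x" "x < b" "\<Phi> a = \<Phi> b"
      using \<open>\<And>x. x \<in> Z\<close>[of x] by (auto simp: Z_def)
    have const: "\<Phi> a = \<Phi> t" if "t \<in> {a<..<b}" for t
      using monoD[OF mono, of a t] monoD[OF mono, of t b] that ab by simp
    show ?thesis
      by (rule has_field_derivative_transform_within_open[OF DERIV_const open_greaterThanLessThan _ const])
        (use ab in simp)
  qed
  then have "\<Phi> (2 * pi) = \<Phi> 0"
    using DERIV_isconst_all by blast
  with per[of 0] show False by simp
qed

text \<open>The assumptions \<open>forward\<close> and \<open>backward\<close> are forward and backward minimality, read on the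
  universal cover.  The proof is the one by an arc of least measure, with minimizing sequences
  replacing the arc: \<open>\<Phi>\<close> need not be continuous, so the infimum might not be attained.  An arc whose
  measure exceeds the infimum by \<open>\<epsilon>\<close> has images under words of length \<open>n\<close> whose measure exceeds it by
  at most \<open>2\<^sup>n \<epsilon>\<close>, because the excess is averaged over the images and is never negative.\<close>

theorem common_visiting_word:
  assumes "open U" and U_periodic: "\<And>t. t + 2 * pi \<in> U \<longleftrightarrow> t \<in> U"
    and forward: "\<And>x. \<exists>w. set w \<subseteq> {1, 2} \<and> fold F w x \<in> U"
    and backward: "\<And>V x. \<lbrakk>open V; V \<noteq> {}; \<And>t. t + 2 * pi \<in> V \<longleftrightarrow> t \<in> V\<rbrakk> \<Longrightarrow>
      \<exists>w t. set w \<subseteq> {1, 2} \<and> t \<in> V \<and> fold F w t = x"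
  obtains w where "set w \<subseteq> {1, 2}" "\<And>x. \<exists>k\<le>length w. fold F (take k w) x \<in> U"
proof -
  define visits where "visits = (\<lambda>w x. \<exists>k\<le>length w. fold F (take k w) x \<in> U)"
  define caught where "caught = (\<lambda>X. \<exists>w. set w \<subseteq> {1, 2} \<and> (\<forall>x\<in>X. visits w x))"
  obtain \<Phi> \<kappa> where mono: "mono \<Phi>" and per: "\<And>x. \<Phi> (x + 2 * pi) = \<Phi> x + 2 * pi"
    and stat: "\<And>x. \<Phi> (F 1 x) + \<Phi> (F 2 x) = 2 * \<Phi> x + \<kappa>"
    using stationary_cdf_exists by blast
  have strict: "strict_mono \<Phi>"
    by (rule stationary_strict_mono[OF mono per stat backward])

  have visits_periodic: "visits w (x + of_int m * (2 * pi)) \<longleftrightarrow> visits w x" for w x and m :: int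
    by (simp add: visits_def fold_periodic translation_invariant_set_int[OF U_periodic])
  have visits_append1: "visits (v @ w) x" if "visits v x" for v w x
  proof -
    from that obtain k where "k \<le> length v" "fold F (take k v) x \<in> U"
      by (auto simp: visits_def)
    then show ?thesis
      by (auto simp: visits_def intro!: exI[of _ k])
  qed
  have visits_append2: "visits (v @ w) x" if "visits w (fold F v x)" for v w x
  proof -
    from that obtain k where "k \<le> length w" "fold F (take k w) (fold F v x) \<in> U"
      by (auto simp: visits_def)
    then show ?thesis
      by (auto simp: visits_def intro!: exI[of _ "length v + k"])
  qed
  have visits_end: "visits w x" if "fold F w x \<in> U" for w x
    using that by (auto simp: visits_def)
  have caught_back: "\<not> caught {F i x..F i y}" if "\<not> caught {x..y}" "i \<in> {1, 2}" for i x y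
  proof
    assume "caught {F i x..F i y}"
    then obtain w where w: "set w \<subseteq> {1, 2}" "\<And>t. t \<in> {F i x..F i y} \<Longrightarrow> visits w t"
      by (auto simp: caught_def)
    have "visits ([i] @ w) t" if "t \<in> {x..y}" for t
      using that w(2)[of "F i t"] by (intro visits_append2) (auto intro: mono_F)
    then have "caught {x..y}"
      unfolding caught_def using w(1) that(2) by (intro exI[of _ "[i] @ w"]) auto
    with that(1) show False by simp
  qed

  have "caught {0..2 * pi}"
  proof (rule ccontr)
    assume escape: "\<not> caught {0..2 * pi}"
    define S where "S = {\<Phi> y - \<Phi> x | x y. x \<le> y \<and> \<not> caught {x..y}}"
    define c where "c = Inf S"
    have "\<Phi> (2 * pi) - \<Phi> 0 \<in> S"
      unfolding S_def using escape by (intro CollectI exI[of _ "0::real"] exI[of _ "2 * pi"]) simp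
    then have S_nonempty: "S \<noteq> {}" by blast
    have "bdd_below S"
      by (rule bdd_belowI[of _ 0]) (auto simp: S_def intro: monoD[OF mono])
    then have c_le: "c \<le> \<Phi> y - \<Phi> x" if "x \<le> y" "\<not> caught {x..y}" for x y
      unfolding c_def by (rule cInf_lower[rotated]) (use that in \<open>auto simp: S_def\<close>)
    have excess: "\<Phi> (fold F v y) - \<Phi> (fold F v x) - c \<le> 2 ^ length v * (\<Phi> y - \<Phi> x - c)"
      if "x \<le> y" "\<not> caught {x..y}" "set v \<subseteq> {1, 2}" for v x y
      using that
    proof (induction v arbitrary: x y)
      case (Cons i v)
      have i: "i \<in> {1, 2}" using Cons.prems by simp
      have "c \<le> \<Phi> (F j y) - \<Phi> (F j x)" if "j \<in> {1, 2}" for j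
        using Cons.prems that by (intro c_le mono_F caught_back)
      from this[of 1] this[of 2]
      have step: "\<Phi> (F i y) - \<Phi> (F i x) - c \<le> 2 * (\<Phi> y - \<Phi> x - c)"
        using stat[of x] stat[of y] i by auto
      have "\<Phi> (fold F v (F i y)) - \<Phi> (fold F v (F i x)) - c \<le>
          2 ^ length v * (\<Phi> (F i y) - \<Phi> (F i x) - c)"
        using Cons.prems i by (intro Cons.IH mono_F caught_back) auto
      also have "\<dots> \<le> 2 ^ length v * (2 * (\<Phi> y - \<Phi> x - c))"
        using step by (intro mult_left_mono) auto
      finally show ?case by (simp only: fold_simps length_Cons power_Suc mult_ac)
    qed simp
    \<comment> \<open>Nearly minimizing arcs, translated so that their left endpoints stay in a compact set.\<close>
    have "\<exists>x y. x \<in> {0..2 * pi} \<and> x \<le> y \<and> \<not> caught {x..y} \<and>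
        \<Phi> y - \<Phi> x < c + inverse (real (Suc n))" for n
    proof -
      have "\<exists>s\<in>S. s < c + inverse (real (Suc n))"
        unfolding c_def using cInf_lessD[OF S_nonempty, of "Inf S + inverse (real (Suc n))"] by simp
      then obtain x y where xy: "x \<le> y" "\<not> caught {x..y}" "\<Phi> y - \<Phi> x < c + inverse (real (Suc n))"
        by (auto simp: S_def)
      obtain n :: int where n: "of_int n * (2 * pi) \<le> x" "x \<le> of_int (n + 1) * (2 * pi)"
        by (rule between_multiples_of_2pi)
      define s where "s = of_int (- n) * (2 * pi)"
      have "x + s \<in> {0..2 * pi}"
        using n by (simp add: s_def algebra_simps)
      moreover have "\<not> caught {x + s..y + s}"
      proof
        assume "caught {x + s..y + s}"
        then obtain w where w: "set w \<subseteq> {1, 2}" "\<And>t. t \<in> {x + s..y + s} \<Longrightarrow> visits w t"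
          by (auto simp: caught_def)
        have "visits w t" if "t \<in> {x..y}" for t
          using w(2)[of "t + s"] that unfolding s_def visits_periodic by simp
        then show False
          using w(1) xy(2) by (auto simp: caught_def)
      qed
      moreover have "\<Phi> (t + s) = \<Phi> t + s" for t
        unfolding s_def by (rule translation_periodic_int) (rule per)
      ultimately show ?thesis
        using xy by (intro exI[of _ "x + s"] exI[of _ "y + s"]) auto
    qed
    then obtain a b where a: "\<And>n. a n \<in> {0..2 * pi}" and ab: "\<And>n. a n \<le> b n"
      and unc: "\<And>n. \<not> caught {a n..b n}"
      and small: "\<And>n. \<Phi> (b n) - \<Phi> (a n) < c + inverse (real (Suc n))"
      by metis
    have "seq_compact {0..2 * pi}"
      by (simp add: compact_imp_seq_compact)
    then obtain l r where r: "strict_mono r" and l: "(a \<circ> r) \<longlonglongrightarrow> l"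
      using a unfolding seq_compact_def by metis
    \<comment> \<open>The word w takes a neighbourhood of l, and with it the left ends of the
      nearly minimizing arcs, into U.\<close>
    obtain w where w: "set w \<subseteq> {1, 2}" "fold F w l \<in> U"
      using forward by blast
    have "open (fold F w -` U)"
      by (rule open_vimage[OF \<open>open U\<close> fold_continuous])
    then obtain e where e: "e > 0" "\<And>t. \<bar>t - l\<bar> < e \<Longrightarrow> fold F w t \<in> U"
      using w(2) unfolding open_dist by (metis dist_real_def vimageE vimageI)
    define p q where "p = fold F w (l + e / 4)" and "q = fold F w (l + e / 2)"
    have "eventually (\<lambda>n. dist ((a \<circ> r) n) l < e / 4) sequentially"
      by (rule tendstoD[OF l]) (use e(1) in simp)
    then have "eventually (\<lambda>n. \<Phi> q - \<Phi> p \<le> 2 ^ length w * inverse (real (Suc (r n)))) sequentially"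
    proof eventually_elim
      case (elim n)
      define x y where "x = a (r n)" and "y = b (r n)"
      have "\<bar>x - l\<bar> < e / 4"
        using elim unfolding x_def dist_real_def o_apply .
      then have x: "l - e / 4 < x" "x < l + e / 4"
        by linarith+
      have xy: "x \<le> y" "\<not> caught {x..y}"
        using ab unc by (auto simp: x_def y_def)
      have near: "visits w t" if "x \<le> t" "t \<le> l + e / 2" for t
        using that x e by (intro visits_end) auto
      have "l + e / 2 < y"
      proof (rule ccontr)
        assume "\<not> l + e / 2 < y"
        then have "caught {x..y}"
          unfolding caught_def using w(1) near by (intro exI[of _ w]) auto
        with xy show False by simp
      qed
      \<comment> \<open>The part of the arc that w may have missed is mapped onto an arc starting at q,
        which is strictly shorter than the image of the whole arc.\<close>
      have "\<not> caught {q..fold F w y}"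
      proof
        assume "caught {q..fold F w y}"
        then obtain v where v: "set v \<subseteq> {1, 2}" "\<And>t. t \<in> {q..fold F w y} \<Longrightarrow> visits v t"
          by (auto simp: caught_def)
        have "visits (w @ v) t" if "t \<in> {x..y}" for t
        proof (cases "t \<le> l + e / 2")
          case True
          with that near show ?thesis by (intro visits_append1) auto
        next
          case False
          with that show ?thesis
            by (intro visits_append2 v(2)) (auto simp: q_def intro!: fold_mono)
        qed
        then have "caught {x..y}"
          unfolding caught_def using w(1) v(1) by (intro exI[of _ "w @ v"]) auto
        with xy show False by simp
      qed
      then have "c \<le> \<Phi> (fold F w y) - \<Phi> q"
        using \<open>l + e / 2 < y\<close> by (intro c_le) (auto simp: q_def intro!: fold_mono)
      moreover have "\<Phi> (fold F w y) - \<Phi> (fold F w x) - c \<le> 2 ^ length w * (\<Phi> y - \<Phi> x - c)"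
        using xy w by (intro excess)
      moreover have "2 ^ length w * (\<Phi> y - \<Phi> x - c) \<le> 2 ^ length w * inverse (real (Suc (r n)))"
        using small[of "r n"] by (intro mult_left_mono) (auto simp: x_def y_def)
      moreover have "\<Phi> (fold F w x) \<le> \<Phi> p"
        unfolding p_def using x by (intro monoD[OF mono] fold_mono) auto
      ultimately show ?case by linarith
    qed
    moreover have "(\<lambda>n. 2 ^ length w * inverse (real (Suc (r n)))) \<longlonglongrightarrow> 0"
      using tendsto_mult_right_zero[OF LIMSEQ_subseq_LIMSEQ[OF LIMSEQ_inverse_real_of_nat r]]
      by (simp add: o_def)
    ultimately have "\<Phi> q - \<Phi> p \<le> 0"
      by (intro tendsto_lowerbound) auto
    moreover have "p < q"
      unfolding p_def q_def using e(1) by (intro fold_strict_mono) auto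
    ultimately show False
      using strict by (auto simp: strict_mono_def dest!: spec)
  qed
  then obtain w where w: "set w \<subseteq> {1, 2}" "\<And>x. x \<in> {0..2 * pi} \<Longrightarrow> visits w x"
    by (auto simp: caught_def)
  have "visits w x" for x
  proof -
    obtain n :: int where "of_int n * (2 * pi) \<le> x" "x \<le> of_int (n + 1) * (2 * pi)"
      by (rule between_multiples_of_2pi)
    then have "x + of_int (- n) * (2 * pi) \<in> {0..2 * pi}"
      by (simp add: algebra_simps)
    with w(2) show ?thesis
      using visits_periodic by blast
  qed
  with w(1) that show thesis
    by (auto simp: visits_def)
qed

end


section \<open>Lifts and derivatives of circle diffeomorphisms\<close>

lemma circle_eq_cis: "z \<in> S1 \<Longrightarrow> z = cis (Arg z)"
  using cis_Arg[of z] by (cases "z = 0") (auto simp: sgn_div_norm)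

lemma cis_eq_iff: "cis s = cis t \<longleftrightarrow> (\<exists>n::int. s = t + of_int n * (2 * pi))"
proof -
  have "cis s = cis t \<longleftrightarrow> cos s = cos t \<and> sin s = sin t"
    by (simp add: complex_eq_iff)
  then show ?thesis
    using sin_cos_eq_iff[of s t] by (auto simp: mult_ac)
qed

lemma bounded_velocity_lipschitz:
  fixes \<gamma> :: "real \<Rightarrow> complex"
  assumes "\<And>t. (\<gamma> has_vector_derivative \<gamma>' t) (at t)" "\<And>t. norm (\<gamma>' t) \<le> B"
  shows "dist (\<gamma> s) (\<gamma> t) \<le> B * \<bar>s - t\<bar>"
proof -
  have "onorm (\<lambda>h. h *\<^sub>R \<gamma>' t) \<le> B" for t
    using assms(2)[of t] by (intro onorm_le) (simp add: mult_left_mono mult.commute[of B])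
  then show ?thesis
    using differentiable_bound[of UNIV \<gamma> "\<lambda>t h. h *\<^sub>R \<gamma>' t" B s t] assms(1)
    by (simp add: has_vector_derivative_def dist_norm)
qed

lemma has_vector_derivative_cis: "(cis has_vector_derivative \<i> * cis t) (at t)"
  by (auto intro!: derivative_eq_intros simp: complex_eq_iff has_vector_derivative_def
      cis_conv_exp scaleR_conv_of_real)

lemma dist_cis_le: "dist (cis s) (cis t) \<le> \<bar>s - t\<bar>"
  using bounded_velocity_lipschitz[of cis "\<lambda>t. \<i> * cis t" 1 s t] has_vector_derivative_cis
  by (simp add: norm_mult)

lemma sin_ge_quarter:
  assumes "0 \<le> v" "v \<le> pi / 2"
  shows "v / 4 \<le> sin v"
proof (cases "v \<le> pi / 3")
  case True
  have "sin 0 - 0 / 4 \<le> sin v - v / 4"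
  proof (rule DERIV_nonneg_imp_nondecreasing[OF \<open>0 \<le> v\<close>])
    fix x assume x: "0 \<le> x" "x \<le> v"
    have "1 / 2 \<le> cos x"
      using cos_monotone_0_pi_le[of x "pi / 3"] x True by (simp add: cos_60)
    then show "\<exists>y. ((\<lambda>x. sin x - x / 4) has_real_derivative y) (at x) \<and> 0 \<le> y"
      by (intro exI[of _ "cos x - 1 / 4"]) (auto intro!: derivative_eq_intros)
  qed
  then show ?thesis by simp
next
  case False
  have "1 / 2 \<le> sqrt 3 / 2"
    by simp
  also have "\<dots> \<le> sin v"
    using sin_monotone_2pi_le[of "pi / 3" v] False assms by (simp add: sin_60)
  finally show ?thesis
    using assms pi_less_4 by simp
qed

text \<open>Distances are measured along chords, derivatives along arcs.  The crude constant 4 suffices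
  because all later estimates allow for a constant factor.\<close>

lemma arc_le_chord:
  assumes "x \<in> S1"
  obtains t where "x = cis t" "\<bar>t - s\<bar> \<le> 4 * dist x (cis s)"
proof -
  define u where "u = Arg (x / cis s)"
  have "x / cis s \<in> S1"
    using assms by (simp add: norm_divide)
  then have u: "x / cis s = cis u"
    unfolding u_def by (rule circle_eq_cis)
  have "\<bar>u\<bar> \<le> pi"
    unfolding u_def using Arg_bounded[of "x / cis s"] by linarith
  have x: "x = cis (s + u)"
    using u by (simp add: field_simps cis_mult)
  have "dist x (cis s) = norm (cis s * (cis u - 1))"
    by (simp add: x dist_norm algebra_simps flip: cis_mult)
  then have "dist x (cis s) = norm (cis u - 1)"
    by (simp add: norm_mult)
  also have "\<dots> = norm (cis (u / 2) * (cis (u / 2) - cis (- (u / 2))))"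
    by (simp add: algebra_simps cis_mult)
  also have "\<dots> = norm (cis (u / 2) - cis (- (u / 2)))"
    by (simp add: norm_mult)
  also have "cis (u / 2) - cis (- (u / 2)) = 2 * \<i> * of_real (sin (u / 2))"
    by (simp add: complex_eq_iff)
  also have "norm \<dots> = 2 * \<bar>sin (u / 2)\<bar>"
    by (simp add: norm_mult)
  also have "\<bar>sin (u / 2)\<bar> = \<bar>sin (\<bar>u\<bar> / 2)\<bar>"
    by (cases "u \<ge> 0") auto
  finally have d: "dist x (cis s) = 2 * \<bar>sin (\<bar>u\<bar> / 2)\<bar>" .
  have "\<bar>u\<bar> / 2 / 4 \<le> sin (\<bar>u\<bar> / 2)"
    using \<open>\<bar>u\<bar> \<le> pi\<close> by (intro sin_ge_quarter) auto
  with d show thesis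
    by (intro that[OF x]) auto
qed

lemma Diff1_maps: "f \<in> Diff1 \<Longrightarrow> z \<in> S1 \<Longrightarrow> f z \<in> S1"
  by (auto simp: Diff1_def bij_betw_def)

lemma Diff1_bij: "f \<in> Diff1 \<Longrightarrow> bij_betw f S1 S1"
  by (simp add: Diff1_def)

lemma Diff1_norm [simp]: "f \<in> Diff1 \<Longrightarrow> norm (f (cis t)) = 1"
  using Diff1_maps[of f "cis t"] by simp

text \<open>A curve in the circle has velocity orthogonal to its position, so no information is lost by
  taking the real part in \<open>circle_deriv\<close>.\<close>

lemma Diff1_velocity:
  assumes "f \<in> Diff1"
  shows "((\<lambda>t. f (cis t)) has_vector_derivative
      of_real (circle_deriv f (cis t)) * (\<i> * f (cis t))) (at t)"
    and "continuous_on UNIV (\<lambda>t. circle_deriv f (cis t))"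
proof -
  have "C1_circle_map f" using assms by (simp add: Diff1_def)
  then obtain D where D: "continuous_on UNIV D"
    "\<And>t. ((\<lambda>t. f (cis t)) has_vector_derivative D t) (at t)"
    "\<And>t. circle_deriv f (cis t) = Re (D t / (\<i> * f (cis t)))"
    using C1_circle_map_deriv_exists by blast
  have nz: "f (cis t) \<noteq> 0" for t
    using Diff1_norm[OF assms, of t] by auto
  have "D t = of_real (circle_deriv f (cis t)) * (\<i> * f (cis t))" for t
  proof -
    let ?z = "f (cis t)"
    have "((\<lambda>t. f (cis t) \<bullet> f (cis t)) has_vector_derivative ?z \<bullet> D t + D t \<bullet> ?z) (at t)"
      by (rule bounded_bilinear.has_vector_derivative[OF bounded_bilinear_inner D(2) D(2)])
    moreover have "(\<lambda>t. f (cis t) \<bullet> f (cis t)) = (\<lambda>_. 1)"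
      using assms by (simp add: dot_square_norm)
    ultimately have "?z \<bullet> D t + D t \<bullet> ?z = 0"
      using vector_derivative_at[of "\<lambda>_. 1::real" _ t] by simp
    then have orth: "Re (D t) * Re ?z + Im (D t) * Im ?z = 0"
      by (simp add: inner_complex_def mult.commute)
    have "Im (D t / (\<i> * ?z)) = 0"
      using orth by (simp add: Im_divide algebra_simps)
    then have "D t / (\<i> * ?z) = of_real (circle_deriv f (cis t))"
      by (simp add: D(3) complex_eq_iff)
    then show ?thesis
      using nz by (simp add: field_simps)
  qed
  with D(2) show "((\<lambda>t. f (cis t)) has_vector_derivative
      of_real (circle_deriv f (cis t)) * (\<i> * f (cis t))) (at t)"
    by simp
  have "continuous_on UNIV (\<lambda>t. f (cis t))"
    using D(2) by (meson continuous_at_imp_continuous_on has_vector_derivative_continuous)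
  then show "continuous_on UNIV (\<lambda>t. circle_deriv f (cis t))"
    unfolding D(3) using D(1) nz by (intro continuous_intros) auto
qed

text \<open>A lift is an antiderivative \<open>F\<close> of the derivative of \<open>f\<close>: the quotient of \<open>f (cis t)\<close> by
  \<open>cis (F t)\<close> has derivative zero.\<close>

lemma Diff1_lift:
  assumes f: "f \<in> Diff1"
  obtains F where "\<And>t. (F has_real_derivative circle_deriv f (cis t)) (at t)"
    "\<And>t. f (cis t) = cis (F t)"
proof -
  let ?D = "\<lambda>t. circle_deriv f (cis t)"
  have "isCont ?D t" for t
    using Diff1_velocity(2)[OF f] by (simp add: continuous_on_eq_continuous_at)
  then obtain F where "\<And>t. (F has_vector_derivative ?D t) (at t)"
    using einterval_antiderivative[of "-\<infinity>" "\<infinity>" ?D] by auto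
  then have F: "(F has_real_derivative ?D t) (at t)" for t
    by (simp add: has_real_derivative_iff_has_vector_derivative)
  have cisF: "((\<lambda>t. cis (- F t)) has_vector_derivative - of_real (?D t) * (\<i> * cis (- F t))) (at t)" for t
  proof -
    have "((\<lambda>t. - F t) has_vector_derivative - ?D t) (at t)"
      using F[of t] by (auto simp: has_real_derivative_iff_has_vector_derivative
          intro!: derivative_eq_intros)
    from vector_diff_chain_at[OF this has_vector_derivative_cis]
    show ?thesis by (simp add: o_def scaleR_conv_of_real)
  qed
  have "((\<lambda>t. f (cis t) * cis (- F t)) has_vector_derivative 0) (at t within UNIV)" for t
    using has_vector_derivative_mult[OF Diff1_velocity(1)[OF f, of t] cisF[of t]]
    by (simp add: algebra_simps)
  then obtain c where c: "\<And>t. f (cis t) * cis (- F t) = c"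
    using has_vector_derivative_zero_constant[of UNIV "\<lambda>t. f (cis t) * cis (- F t)"] by auto
  have "norm c = 1"
    using c[of 0] f by (metis Diff1_norm mult_1 norm_cis norm_mult)
  then have "c = cis (Arg c)"
    by (intro circle_eq_cis) simp
  have "f (cis t) = cis (F t + Arg c)" for t
  proof -
    have "f (cis t) = (f (cis t) * cis (- F t)) * cis (F t)"
      by (simp add: mult.assoc cis_mult)
    also have "\<dots> = cis (F t + Arg c)"
      unfolding c using \<open>c = cis (Arg c)\<close> by (metis add.commute cis_mult)
    finally show ?thesis .
  qed
  moreover have "((\<lambda>t. F t + Arg c) has_real_derivative ?D t) (at t)" for t
    using F[of t] by (auto intro!: derivative_eq_intros)
  ultimately show thesis
    by (rule that[rotated])
qed

lemma lift_strict_mono: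
  assumes "\<And>t. (F has_real_derivative F' t) (at t)" "\<And>t. F' t > 0"
  shows "strict_mono F"
  unfolding strict_mono_def using DERIV_pos_imp_increasing[of _ _ F] assms by blast

text \<open>The increment of \<open>F\<close> over a period is a positive multiple of \<open>2\<pi>\<close>, and a multiple larger than
  \<open>2\<pi>\<close> would make \<open>f\<close> take the value \<open>f 1\<close> twice.\<close>

lemma orientation_preserving_lift:
  assumes f: "f \<in> Diff1" and op: "orientation_preserving f"
  obtains F where "\<And>t. (F has_real_derivative circle_deriv f (cis t)) (at t)"
    "\<And>t. f (cis t) = cis (F t)" "strict_mono F" "\<And>t. F (t + 2 * pi) = F t + 2 * pi"
proof -
  obtain F where F: "\<And>t. (F has_real_derivative circle_deriv f (cis t)) (at t)"
    "\<And>t. f (cis t) = cis (F t)"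
    using Diff1_lift[OF f] by blast
  have strict: "strict_mono F"
    using op by (intro lift_strict_mono[OF F(1)]) (simp add: orientation_preserving_def)
  have cis_2pi: "cis (t + 2 * pi) = cis t" for t
    using cis_eq_iff[of "t + 2 * pi" t] by (auto intro: exI[of _ 1])
  have "((\<lambda>t. F (t + 2 * pi) - F t) has_real_derivative 0) (at t)" for t
  proof -
    have "((\<lambda>t. F (t + 2 * pi)) has_real_derivative circle_deriv f (cis t)) (at t)"
      using F(1)[of "t + 2 * pi"] unfolding DERIV_shift[symmetric] by (simp only: cis_2pi)
    from DERIV_diff[OF this F(1)[of t]] show ?thesis by simp
  qed
  then have const: "F (t + 2 * pi) - F t = F (2 * pi) - F 0" for t
    using DERIV_isconst_all[of "\<lambda>t. F (t + 2 * pi) - F t" t 0] by simp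
  have "cis (F (2 * pi)) = cis (F 0)"
    using cis_2pi[of 0] F(2)[of "2 * pi"] F(2)[of 0] by simp
  then obtain n :: int where n: "F (2 * pi) = F 0 + of_int n * (2 * pi)"
    by (auto simp: cis_eq_iff)
  have "F 0 < F (2 * pi)"
    using strict by (simp add: strict_mono_def)
  then have "n \<ge> 1"
    using n by (simp add: zero_less_mult_iff)
  moreover have "\<not> n \<ge> 2"
  proof
    assume "n \<ge> 2"
    then have "2 * (2 * pi) \<le> of_int n * (2 * pi)"
      by (intro mult_right_mono) auto
    then have "F 0 + 2 * pi < F (2 * pi)"
      using n pi_gt_zero by linarith
    moreover have "continuous_on {0..2 * pi} F"
      using F(1) by (meson DERIV_isCont continuous_at_imp_continuous_on)
    ultimately obtain s where s: "0 \<le> s" "s \<le> 2 * pi" "F s = F 0 + 2 * pi"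
      using IVT'[of F 0 "F 0 + 2 * pi" "2 * pi"] by auto
    have "f (cis s) = f (cis 0)"
      unfolding F(2) s(3) by (rule cis_2pi)
    then have "cis s = cis 0"
      using Diff1_bij[OF f] unfolding bij_betw_def inj_on_def by simp
    then obtain m :: int where m: "s = of_int m * (2 * pi)"
      unfolding cis_eq_iff by auto
    have "s \<noteq> 0" "s \<noteq> 2 * pi"
      using s \<open>F 0 + 2 * pi < F (2 * pi)\<close> by auto
    then have "0 < of_int m * (2 * pi)" "of_int m * (2 * pi) < 1 * (2 * pi)"
      unfolding m[symmetric] using s \<open>s \<noteq> 0\<close> \<open>s \<noteq> 2 * pi\<close> by linarith+
    then have "0 < m" "m < 1"
      by (simp_all add: zero_less_mult_iff)
    then show False by simp
  qed
  ultimately have "n = 1" by simp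
  then have "F (t + 2 * pi) = F t + 2 * pi" for t
    using const[of t] n by simp
  with F strict show thesis by (rule that)
qed

lemma monotone_displacement_imp_constant:
  fixes F :: "real \<Rightarrow> real"
  assumes "mono (\<lambda>t. F t - t) \<or> antimono (\<lambda>t. F t - t)" "\<And>t. F (t + 2 * pi) = F t + 2 * pi"
  shows "F t = t + F 0"
proof -
  obtain n :: int where t: "of_int n * (2 * pi) \<le> t" "t \<le> of_int (n + 1) * (2 * pi)"
    by (rule between_multiples_of_2pi)
  have "F (of_int m * (2 * pi)) - of_int m * (2 * pi) = F 0" for m :: int
    using translation_periodic_int[of F "2 * pi" 0 m] assms(2) by simp
  then show ?thesis
    using assms(1) t unfolding mono_def antimono_def by (smt (verit, best))
qed

text \<open>If the derivative stays on one side of 1, the displacement \<open>F t - t\<close> is both monotone and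
  periodic, hence constant, and \<open>f\<close> is a rotation.\<close>

lemma not_conjugate_imp_both_sides:
  assumes f: "f \<in> Diff1" and op: "orientation_preserving f" and "\<not> conjugate_to_rotation f"
  obtains p q where "p \<in> S1" "circle_deriv f p < 1" "q \<in> S1" "circle_deriv f q > 1"
proof -
  obtain F where F: "\<And>t. (F has_real_derivative circle_deriv f (cis t)) (at t)"
    "\<And>t. f (cis t) = cis (F t)" "strict_mono F" "\<And>t. F (t + 2 * pi) = F t + 2 * pi"
    by (rule orientation_preserving_lift[OF f op]) (rule that)
  have H: "((\<lambda>t. F t - t) has_real_derivative circle_deriv f (cis t) - 1) (at t)" for t
    using F(1)[of t] by (auto intro!: derivative_eq_intros)
  have "\<not> (mono (\<lambda>t. F t - t) \<or> antimono (\<lambda>t. F t - t))"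
  proof
    assume "mono (\<lambda>t. F t - t) \<or> antimono (\<lambda>t. F t - t)"
    then have F_eq: "F t = t + F 0" for t
      using F(4) by (rule monotone_displacement_imp_constant)
    have "f z = rotation (F 0 / (2 * pi)) z" if "z \<in> S1" for z
    proof -
      obtain t where t: "z = cis t"
        using circle_eq_cis[OF \<open>z \<in> S1\<close>] by blast
      show ?thesis
        unfolding t F(2) F_eq[of t] by (simp add: rotation_def cis_mult add.commute)
    qed
    then have "conjugate_to_rotation f"
      unfolding conjugate_to_rotation_def
      by (intro exI[of _ "F 0 / (2 * pi)"] exI[of _ id]) (auto simp: homeomorphism_def)
    with assms(3) show False by simp
  qed
  moreover have "mono (\<lambda>t. F t - t)" if "\<And>z. z \<in> S1 \<Longrightarrow> circle_deriv f z \<ge> 1"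
  proof (rule monoI)
    fix s t :: real assume "s \<le> t"
    then show "F s - s \<le> F t - t"
    proof (rule DERIV_nonneg_imp_nondecreasing)
      fix x
      show "\<exists>y. ((\<lambda>t. F t - t) has_real_derivative y) (at x) \<and> 0 \<le> y"
        using H[of x] that[of "cis x"] by (intro exI[of _ "circle_deriv f (cis x) - 1"]) simp
    qed
  qed
  moreover have "antimono (\<lambda>t. F t - t)" if "\<And>z. z \<in> S1 \<Longrightarrow> circle_deriv f z \<le> 1"
  proof (rule antimonoI)
    fix s t :: real assume "s \<le> t"
    then show "F t - t \<le> F s - s"
    proof (rule DERIV_nonpos_imp_nonincreasing)
      fix x
      show "\<exists>y. ((\<lambda>t. F t - t) has_real_derivative y) (at x) \<and> y \<le> 0"
        using H[of x] that[of "cis x"] by (intro exI[of _ "circle_deriv f (cis x) - 1"]) simp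
    qed
  qed
  ultimately show thesis
    using that by (meson not_le)
qed

lemma curve_near_linear:
  fixes \<gamma> :: "real \<Rightarrow> complex"
  assumes \<gamma>: "\<And>t. (\<gamma> has_vector_derivative \<gamma>' t) (at t)" and "isCont \<gamma>' t0" and "e > 0"
  obtains d where "d > 0"
    "\<And>s t. \<lbrakk>\<bar>s - t0\<bar> < d; \<bar>t - t0\<bar> < d\<rbrakk> \<Longrightarrow>
      \<bar>dist (\<gamma> s) (\<gamma> t) - norm (\<gamma>' t0) * \<bar>s - t\<bar>\<bar> \<le> e * \<bar>s - t\<bar>"
proof -
  obtain d where d: "d > 0" "\<And>t. \<bar>t - t0\<bar> < d \<Longrightarrow> norm (\<gamma>' t - \<gamma>' t0) < e"
    using \<open>isCont \<gamma>' t0\<close> \<open>e > 0\<close> unfolding continuous_at_eps_delta dist_norm real_norm_def by blast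
  show thesis
  proof (rule that[OF d(1)])
    fix s t assume st: "\<bar>s - t0\<bar> < d" "\<bar>t - t0\<bar> < d"
    have "norm (\<gamma> s - \<gamma> t - (s - t) *\<^sub>R \<gamma>' t0) \<le> norm (s - t) * e"
    proof (rule vector_differentiable_bound_linearization)
      show "(\<gamma> has_vector_derivative \<gamma>' x) (at x within ball t0 d)" for x
        using \<gamma> has_vector_derivative_at_within by blast
      show "closed_segment t s \<subseteq> ball t0 d"
        using st by (intro closed_segment_subset) (auto simp: dist_real_def abs_minus_commute)
      show "norm (\<gamma>' x - \<gamma>' t0) \<le> e" if "x \<in> ball t0 d" for x
        using d(2)[of x] that by (simp add: dist_real_def abs_minus_commute less_imp_le)
    qed (use d(1) in auto)
    then show "\<bar>dist (\<gamma> s) (\<gamma> t) - norm (\<gamma>' t0) * \<bar>s - t\<bar>\<bar> \<le> e * \<bar>s - t\<bar>"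
      using norm_triangle_ineq3[of "\<gamma> s - \<gamma> t" "(s - t) *\<^sub>R \<gamma>' t0"]
      by (simp add: dist_norm mult.commute)
  qed
qed

text \<open>Continuity of the derivative makes the estimate hold for all pairs of points near \<open>p\<close>, not only
  for pairs that contain \<open>p\<close>.\<close>

lemma circle_deriv_local_stretch:
  assumes f: "f \<in> Diff1" and "p \<in> S1" "e > 0"
  obtains r where "r > 0"
    "\<And>x y. \<lbrakk>x \<in> S1; y \<in> S1; dist x p < r; dist y p < r\<rbrakk> \<Longrightarrow>
      dist (f x) (f y) \<le> (\<bar>circle_deriv f p\<bar> + e) * dist x y"
    "\<And>x y. \<lbrakk>x \<in> S1; y \<in> S1; dist x p < r; dist y p < r\<rbrakk> \<Longrightarrow>
      (\<bar>circle_deriv f p\<bar> - e) * dist x y \<le> dist (f x) (f y)"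
proof -
  define t0 where "t0 = Arg p"
  define D where "D = \<bar>circle_deriv f p\<bar>"
  have p: "p = cis t0"
    unfolding t0_def using \<open>p \<in> S1\<close> by (rule circle_eq_cis)
  have "D \<ge> 0" by (simp add: D_def)
  \<comment> \<open>A relative error k in the arc lengths of x and of f x stays within e for the quotient,
    since (D + k) / (1 - k) <= D + e.\<close>
  define k where "k = min (1 / 2) (e / (1 + D + e))"
  have k: "0 < k" "k < 1" "k \<le> e" "k * (1 + D + e) \<le> e"
  proof -
    show "0 < k" "k < 1" using \<open>e > 0\<close> \<open>D \<ge> 0\<close> by (auto simp: k_def)
    have "k \<le> e / (1 + D + e)" by (simp add: k_def)
    then show "k * (1 + D + e) \<le> e"
      using \<open>e > 0\<close> \<open>D \<ge> 0\<close> by (simp add: field_simps)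
    have "k * 1 \<le> k * (1 + D + e)"
      using \<open>0 < k\<close> \<open>e > 0\<close> \<open>D \<ge> 0\<close> by (intro mult_left_mono) auto
    with \<open>k * (1 + D + e) \<le> e\<close> show "k \<le> e" by simp
  qed
  let ?\<gamma>' = "\<lambda>t. of_real (circle_deriv f (cis t)) * (\<i> * f (cis t))"
  have "continuous_on UNIV (\<lambda>t. f (cis t))"
    using Diff1_velocity(1)[OF f]
    by (meson continuous_at_imp_continuous_on has_vector_derivative_continuous)
  then have "continuous_on UNIV ?\<gamma>'"
    by (intro continuous_intros Diff1_velocity(2)[OF f])
  then have "isCont ?\<gamma>' t0"
    by (simp add: continuous_on_eq_continuous_at)
  from curve_near_linear[of "\<lambda>t. f (cis t)" ?\<gamma>', OF Diff1_velocity(1)[OF f] this k(1)]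
  obtain d1 where d1: "d1 > 0"
    "\<And>s t. \<lbrakk>\<bar>s - t0\<bar> < d1; \<bar>t - t0\<bar> < d1\<rbrakk> \<Longrightarrow>
      \<bar>dist (f (cis s)) (f (cis t)) - D * \<bar>s - t\<bar>\<bar> \<le> k * \<bar>s - t\<bar>"
    using f by (auto simp: D_def p norm_mult)
  have "isCont (\<lambda>t. \<i> * cis t) t0"
    using has_vector_derivative_continuous[OF has_vector_derivative_cis]
    by (intro continuous_intros)
  from curve_near_linear[of cis "\<lambda>t. \<i> * cis t", OF has_vector_derivative_cis this k(1)]
  obtain d2 where d2: "d2 > 0"
    "\<And>s t. \<lbrakk>\<bar>s - t0\<bar> < d2; \<bar>t - t0\<bar> < d2\<rbrakk> \<Longrightarrow>
      \<bar>dist (cis s) (cis t) - \<bar>s - t\<bar>\<bar> \<le> k * \<bar>s - t\<bar>"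
    by (auto simp: norm_mult)
  have est: "dist (f x) (f y) \<le> (D + e) * dist x y \<and> (D - e) * dist x y \<le> dist (f x) (f y)"
    if xy: "x \<in> S1" "y \<in> S1" "dist x p < min d1 d2 / 4" "dist y p < min d1 d2 / 4" for x y
  proof -
    obtain s where s: "x = cis s" "\<bar>s - t0\<bar> \<le> 4 * dist x (cis t0)"
      using arc_le_chord[OF xy(1)] by blast
    obtain t where t: "y = cis t" "\<bar>t - t0\<bar> \<le> 4 * dist y (cis t0)"
      using arc_le_chord[OF xy(2)] by blast
    define h where "h = \<bar>s - t\<bar>"
    have "h \<ge> 0" by (simp add: h_def)
    have near: "\<bar>s - t0\<bar> < d1" "\<bar>t - t0\<bar> < d1" "\<bar>s - t0\<bar> < d2" "\<bar>t - t0\<bar> < d2"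
      using s t xy p by auto
    have f_h: "\<bar>dist (f x) (f y) - D * h\<bar> \<le> k * h"
      using d1(2)[OF near(1,2)] by (simp add: s t h_def)
    have "\<bar>dist x y - h\<bar> \<le> k * h"
      using d2(2)[OF near(3,4)] by (simp add: s t h_def)
    then have lower: "(1 - k) * h \<le> dist x y"
      by (simp add: algebra_simps abs_le_iff)
    have upper: "dist x y \<le> h"
      using dist_cis_le by (simp add: s t h_def)
    have "dist (f x) (f y) \<le> (D + k) * h"
      using f_h by (simp add: algebra_simps abs_le_iff)
    also have "\<dots> \<le> (D + e) * ((1 - k) * h)"
    proof -
      have "D + k \<le> (D + e) * (1 - k)"
        using k(4) by (simp add: algebra_simps)
      from mult_right_mono[OF this \<open>h \<ge> 0\<close>] show ?thesis by (simp add: mult.assoc)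
    qed
    also have "\<dots> \<le> (D + e) * dist x y"
      using lower \<open>D \<ge> 0\<close> \<open>e > 0\<close> by (intro mult_left_mono) auto
    finally have up: "dist (f x) (f y) \<le> (D + e) * dist x y" .
    have "(D - e) * dist x y \<le> dist (f x) (f y)"
    proof (cases "D \<le> e")
      case True
      then have "(D - e) * dist x y \<le> 0"
        by (simp add: mult_nonpos_nonneg)
      then show ?thesis using zero_le_dist order_trans by blast
    next
      case False
      then have "(D - e) * dist x y \<le> (D - e) * h"
        using upper by (intro mult_left_mono) auto
      also have "\<dots> \<le> (D - k) * h"
        using k(3) \<open>h \<ge> 0\<close> by (intro mult_right_mono) auto
      also have "\<dots> \<le> dist (f x) (f y)"
        using f_h by (simp add: algebra_simps abs_le_iff)
      finally show ?thesis .
    qed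
    with up show ?thesis by simp
  qed
  show thesis
    using est d1(1) d2(1) by (intro that[of "min d1 d2 / 4"]) (auto simp: D_def)
qed

text \<open>This turns closeness in the \<open>C\<^sup>1\<close>-metric into a statement about chords in which derivatives no
  longer occur: contraction and expansion rates change by an arbitrarily small amount.\<close>

lemma C1_close_difference_lipschitz:
  assumes f: "f \<in> Diff1" and g: "g \<in> Diff1"
    and close: "\<And>z. z \<in> S1 \<Longrightarrow> dist (f z) (g z) \<le> \<delta>"
    and deriv: "\<And>z. z \<in> S1 \<Longrightarrow> \<bar>circle_deriv f z - circle_deriv g z\<bar> \<le> \<delta>"
    and M: "\<And>z. z \<in> S1 \<Longrightarrow> \<bar>circle_deriv g z\<bar> \<le> M"
    and xy: "x \<in> S1" "y \<in> S1"
  shows "dist (f x - g x) (f y - g y) \<le> 4 * (1 + M) * \<delta> * dist x y"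
proof -
  have "0 \<le> dist (f x) (g x)" by simp
  then have "\<delta> \<ge> 0" using close[OF xy(1)] by linarith
  have "M \<ge> 0" using M[OF xy(1)] by linarith
  obtain t where t: "y = cis t"
    using circle_eq_cis[OF xy(2)] by blast
  obtain s where s: "x = cis s" "\<bar>s - t\<bar> \<le> 4 * dist x (cis t)"
    using arc_le_chord[OF xy(1)] by blast
  let ?v = "\<lambda>h t. of_real (circle_deriv h (cis t)) * (\<i> * h (cis t))"
  have "norm (?v f t - ?v g t) \<le> (1 + M) * \<delta>" for t
  proof -
    have "?v f t - ?v g t = \<i> * (of_real (circle_deriv f (cis t) - circle_deriv g (cis t)) * f (cis t)
        + of_real (circle_deriv g (cis t)) * (f (cis t) - g (cis t)))"
      by (simp add: algebra_simps)
    also have "norm \<dots> = norm (of_real (circle_deriv f (cis t) - circle_deriv g (cis t)) * f (cis t)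
        + of_real (circle_deriv g (cis t)) * (f (cis t) - g (cis t)))"
      by (simp add: norm_mult)
    also have "\<dots> \<le> norm (of_real (circle_deriv f (cis t) - circle_deriv g (cis t)) * f (cis t))
        + norm (of_real (circle_deriv g (cis t)) * (f (cis t) - g (cis t)))"
      by (rule norm_triangle_ineq)
    also have "\<dots> = \<bar>circle_deriv f (cis t) - circle_deriv g (cis t)\<bar> * 1
        + \<bar>circle_deriv g (cis t)\<bar> * dist (f (cis t)) (g (cis t))"
      by (simp only: norm_mult norm_of_real Diff1_norm[OF f] dist_norm)
    also have "\<dots> \<le> \<delta> * 1 + M * \<delta>"
      using close[of "cis t"] deriv[of "cis t"] M[of "cis t"] \<open>M \<ge> 0\<close>
      by (intro add_mono mult_mono) auto
    finally show ?thesis by (simp add: algebra_simps)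
  qed
  moreover have "((\<lambda>t. f (cis t) - g (cis t)) has_vector_derivative ?v f t - ?v g t) (at t)" for t
    by (intro derivative_intros Diff1_velocity f g)
  ultimately have "dist (f x - g x) (f y - g y) \<le> (1 + M) * \<delta> * \<bar>s - t\<bar>"
    unfolding s(1) t by (rule bounded_velocity_lipschitz[rotated])
  also have "\<dots> \<le> (1 + M) * \<delta> * (4 * dist x y)"
    using s(2) t \<open>\<delta> \<ge> 0\<close> \<open>M \<ge> 0\<close> by (intro mult_left_mono) auto
  finally show ?thesis by (simp add: mult_ac)
qed


section \<open>Contraction combined with an almost isometric rotation\<close>

lemma IFS_closed_on_circle:
  assumes "h \<in> IFS a b" "\<And>z. z \<in> S1 \<Longrightarrow> a z \<in> S1" "\<And>z. z \<in> S1 \<Longrightarrow> b z \<in> S1" "z \<in> S1"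
  shows "h z \<in> S1"
  using assms(1,4)
proof (induction arbitrary: z rule: IFS.induct)
  case (comp h k)
  then show ?case by (simp add: compose_def)
qed (use assms in auto)

lemma dense_in_circleI:
  assumes "A \<subseteq> S1" "\<And>y e. \<lbrakk>y \<in> S1; e > 0\<rbrakk> \<Longrightarrow> \<exists>x\<in>A. dist x y < e"
  shows "dense_in_circle A"
proof -
  have "S1 \<subseteq> closure A"
    using assms(2) by (auto simp: closure_approachable)
  moreover have "closure A \<subseteq> S1"
    using assms(1) by (simp add: closure_minimal)
  ultimately show ?thesis
    using assms(1) by (auto simp: dense_in_circle_def)
qed

lemma dense_in_circle_mono:
  assumes "dense_in_circle A" "A \<subseteq> B" "B \<subseteq> S1"
  shows "dense_in_circle B"
proof -
  have "S1 \<subseteq> closure B"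
    using closure_mono[OF assms(2)] assms(1) by (simp add: dense_in_circle_def)
  moreover have "closure B \<subseteq> S1"
    using assms(3) by (simp add: closure_minimal)
  ultimately show ?thesis
    using assms(3) by (simp add: dense_in_circle_def)
qed

lemma IFS_iterate:
  "\<exists>h\<in>IFS a b. \<forall>z\<in>S1. h z = (a ^^ Suc n) z" if "\<And>z. z \<in> S1 \<Longrightarrow> a z \<in> S1"
proof (induction n)
  case 0
  then show ?case by (auto intro!: bexI[of _ a] IFS.gen1)
next
  case (Suc n)
  then obtain h where h: "h \<in> IFS a b" "\<forall>z\<in>S1. h z = (a ^^ Suc n) z" by blast
  show ?case
    by (rule bexI[OF _ IFS.comp[OF IFS.gen1 h(1)]]) (use h(2) in \<open>simp add: compose_def\<close>)
qed

text \<open>The robust mechanism behind all conclusions.  By \<open>pull\<close>, every point has a preimage around which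
  some word contracts, at a scale \<open>r\<close> that does not depend on the point; by \<open>reach\<close>, that scale is
  met by every orbit, along words with a common Lipschitz constant.\<close>

locale contracting_pair =
  fixes a b :: "complex \<Rightarrow> complex" and \<mu> r K :: real
  assumes maps_a: "z \<in> S1 \<Longrightarrow> a z \<in> S1" and maps_b: "z \<in> S1 \<Longrightarrow> b z \<in> S1"
    and \<mu>: "0 \<le> \<mu>" "\<mu> < 1" and r_pos: "r > 0" and K_nonneg: "K \<ge> 0"
    and pull: "y \<in> S1 \<Longrightarrow>
      \<exists>h\<in>IFS a b. \<exists>u\<in>S1. h u = y \<and> \<mu>-lipschitz_on (S1 \<inter> ball u r) h"
    and reach: "\<lbrakk>x \<in> S1; u \<in> S1\<rbrakk> \<Longrightarrow>
      \<exists>k\<in>IFS a b. dist (k x) u < r / 2 \<and> K-lipschitz_on S1 k"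
begin

lemma IFS_maps: "h \<in> IFS a b \<Longrightarrow> z \<in> S1 \<Longrightarrow> h z \<in> S1"
  using IFS_closed_on_circle maps_a maps_b by blast

text \<open>Contracting words can be composed: the inner word maps the ball around its own base point into
  the ball on which the outer word contracts.\<close>

lemma deep_pull:
  assumes "y \<in> S1"
  shows "\<exists>h\<in>IFS a b. \<exists>u\<in>S1. h u = y \<and> (\<mu> ^ Suc n)-lipschitz_on (S1 \<inter> ball u r) h"
  using assms
proof (induction n arbitrary: y)
  case 0
  then show ?case using pull by simp
next
  case (Suc n)
  obtain h u where h: "h \<in> IFS a b" "u \<in> S1" "h u = y" "\<mu>-lipschitz_on (S1 \<inter> ball u r) h"
    using pull[OF Suc.prems] by blast
  obtain k v where k: "k \<in> IFS a b" "v \<in> S1" "k v = u"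
    "(\<mu> ^ Suc n)-lipschitz_on (S1 \<inter> ball v r) k"
    using Suc.IH[OF h(2)] by blast
  have "k ` (S1 \<inter> ball v r) \<subseteq> S1 \<inter> ball u r"
  proof (rule image_subsetI)
    fix x assume x: "x \<in> S1 \<inter> ball v r"
    have "dist (k v) (k x) \<le> \<mu> ^ Suc n * dist v x"
      using k(2) x r_pos by (intro lipschitz_onD[OF k(4)]) auto
    also have "\<dots> \<le> 1 * dist v x"
      using \<mu> by (intro mult_right_mono power_le_one) auto
    finally show "k x \<in> S1 \<inter> ball u r"
      using x k IFS_maps[of k x] by simp
  qed
  then have "\<mu>-lipschitz_on (k ` (S1 \<inter> ball v r)) h"
    by (rule lipschitz_on_subset[OF h(4)])
  from lipschitz_on_compose[OF k(4) this]
  have "(\<mu> ^ Suc (Suc n))-lipschitz_on (S1 \<inter> ball v r) (h \<circ> k)"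
    by simp
  then have "(\<mu> ^ Suc (Suc n))-lipschitz_on (S1 \<inter> ball v r) (compose S1 h k)"
    by (rule lipschitz_on_transform) (simp add: compose_def)
  moreover have "compose S1 h k v = y"
    using h k by (simp add: compose_def)
  ultimately show ?case
    using IFS.comp[OF h(1) k(1)] k(2) by blast
qed

lemma orbit_approaches:
  assumes "x \<in> S1" "y \<in> S1" "e > 0"
  shows "\<exists>h\<in>IFS a b. dist (h x) y < e"
proof -
  obtain n where n: "\<mu> ^ n < e / r"
    using real_arch_pow_inv[of "e / r" \<mu>] \<mu> \<open>e > 0\<close> r_pos by auto
  obtain h u where h: "h \<in> IFS a b" "u \<in> S1" "h u = y"
    "(\<mu> ^ Suc n)-lipschitz_on (S1 \<inter> ball u r) h"
    using deep_pull[OF \<open>y \<in> S1\<close>] by blast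
  obtain k where k: "k \<in> IFS a b" "dist (k x) u < r / 2"
    using reach[OF \<open>x \<in> S1\<close> h(2)] by blast
  have "dist (h (k x)) y \<le> \<mu> ^ Suc n * dist (k x) u"
    using lipschitz_onD[OF h(4), of "k x" u] h(2,3) k IFS_maps[of k x] \<open>x \<in> S1\<close> r_pos
    by (simp add: dist_commute)
  also have "\<dots> \<le> \<mu> ^ n * r"
    using \<mu> k(2) r_pos by (intro mult_mono) (auto simp: mult_left_le_one_le)
  also have "\<dots> < e"
    using n r_pos by (simp add: field_simps)
  finally show ?thesis
    using \<open>x \<in> S1\<close> by (intro bexI[OF _ IFS.comp[OF h(1) k(1)]]) (simp add: compose_def)
qed

lemma minimal: "minimal_IFS a b"
  unfolding minimal_IFS_def
proof (intro ballI dense_in_circleI)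
  fix x :: complex assume x: "x \<in> S1"
  show "IFS_orbit a b x \<subseteq> S1"
    using IFS_maps x by (auto simp: IFS_orbit_def)
  fix y :: complex and e :: real assume "y \<in> S1" "e > 0"
  then show "\<exists>z\<in>IFS_orbit a b x. dist z y < e"
    using orbit_approaches[OF x] by (fastforce simp: IFS_orbit_def)
qed

text \<open>In the proof, the word \<open>h\<close> squeezes a ball of radius \<open>r\<close> around some \<open>u\<close> towards \<open>y\<close>, and \<open>k\<close> brings \<open>y\<close> near \<open>u\<close>.
  A ball around \<open>y\<close> so small that \<open>k\<close> maps it into the ball around \<open>u\<close> is mapped into itself by
  \<open>h \<circ> k\<close>, since the contraction of \<open>h\<close> can be chosen after the Lipschitz constant \<open>K\<close> of \<open>k\<close> and the
  radius \<open>e'\<close> are known.\<close>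

lemma attracting_fixed_point:
  assumes "y \<in> S1" "e > 0"
  obtains h q L where "h \<in> IFS a b" "q \<in> S1" "dist q y < e" "h q = q" "L < 1"
    "\<exists>\<eta>>0. \<forall>x\<in>S1. dist x q < \<eta> \<longrightarrow> dist (h x) q \<le> L * dist x q"
proof -
  define e' where "e' = min e (r / (2 * (K + 1)))"
  have e': "0 < e'" "e' \<le> e"
    using r_pos K_nonneg \<open>e > 0\<close> by (auto simp: e'_def)
  have "K * e' < r / 2"
  proof -
    have "(K + 1) * e' \<le> (K + 1) * (r / (2 * (K + 1)))"
      using K_nonneg by (intro mult_left_mono) (auto simp: e'_def)
    also have "\<dots> = r / 2"
      using K_nonneg by (simp add: field_simps)
    finally show ?thesis using e'(1) by (simp add: algebra_simps)
  qed
  obtain n where n: "\<mu> ^ n < min (1 / (2 * (K + 1))) (e' / (2 * r))"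
    using real_arch_pow_inv[of "min (1 / (2 * (K + 1))) (e' / (2 * r))" \<mu>] \<mu> e' K_nonneg r_pos
    by auto
  define c where "c = \<mu> ^ Suc n"
  have "c \<le> 1 * \<mu> ^ n"
    unfolding c_def power_Suc using \<mu> by (intro mult_right_mono) auto
  then have "c \<le> 1 / (2 * (K + 1))" "c \<le> e' / (2 * r)" "c \<ge> 0"
    using n \<mu> by (auto simp: c_def)
  have cK: "c * K \<le> 1 / 2"
  proof -
    have "c * K \<le> 1 / (2 * (K + 1)) * (K + 1)"
      using K_nonneg \<open>c \<le> 1 / (2 * (K + 1))\<close> \<open>c \<ge> 0\<close> by (intro mult_mono) auto
    also have "\<dots> = 1 / 2"
      using K_nonneg by (simp add: field_simps)
    finally show ?thesis .
  qed
  have cr: "c * r \<le> e' / 2"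
    using \<open>c \<le> e' / (2 * r)\<close> r_pos by (simp add: field_simps)
  obtain h u where h: "h \<in> IFS a b" "u \<in> S1" "h u = y" "c-lipschitz_on (S1 \<inter> ball u r) h"
    using deep_pull[OF \<open>y \<in> S1\<close>, of n] unfolding c_def by blast
  obtain k where k: "k \<in> IFS a b" "dist (k y) u < r / 2"
    "K-lipschitz_on S1 k"
    using reach[OF \<open>y \<in> S1\<close> h(2)] by blast
  define X where "X = S1 \<inter> cball y e'"
  have k_near: "dist (k x) u < r" if "x \<in> X" for x
  proof -
    have "dist (k x) (k y) \<le> K * dist x y"
      using that \<open>y \<in> S1\<close> by (intro lipschitz_onD[OF k(3)]) (auto simp: X_def)
    also have "\<dots> \<le> K * e'"
      using that K_nonneg by (intro mult_left_mono) (auto simp: X_def dist_commute)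
    finally show ?thesis
      using k(2) \<open>K * e' < r / 2\<close> dist_triangle[of "k x" u "k y"] by linarith
  qed
  have k_S1: "k x \<in> S1" if "x \<in> X" for x
    using that k(1) IFS_maps by (auto simp: X_def)
  have close: "dist (h (k x)) y \<le> e' / 2" if "x \<in> X" for x
  proof -
    have "dist (h (k x)) (h u) \<le> c * dist (k x) u"
      using k_near[OF that] k_S1[OF that] h(2) r_pos 
      by (intro lipschitz_onD[OF h(4)]) (auto simp: dist_commute)
    also have "\<dots> \<le> c * r"
      using k_near[OF that] \<open>c \<ge> 0\<close> by (intro mult_left_mono) auto
    finally show ?thesis using cr h(3) by simp
  qed
  have contraction: "dist (h (k x)) (h (k x')) \<le> 1 / 2 * dist x x'" if "x \<in> X" "x' \<in> X" for x x'
  proof -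
    have "dist (h (k x)) (h (k x')) \<le> c * dist (k x) (k x')"
      using k_near k_S1 that by (intro lipschitz_onD[OF h(4)]) (auto simp: dist_commute)
    also have "\<dots> \<le> c * (K * dist x x')"
      using that \<open>c \<ge> 0\<close> by (intro mult_left_mono lipschitz_onD[OF k(3)]) (auto simp: X_def)
    also have "\<dots> \<le> 1 / 2 * dist x x'"
      using mult_right_mono[OF cK zero_le_dist[of x x']] by (simp add: mult.assoc)
    finally show ?thesis .
  qed
  have "complete X"
    unfolding X_def by (intro compact_imp_complete compact_Int_closed compact_sphere closed_cball)
  moreover have "y \<in> X"
    using \<open>y \<in> S1\<close> e' by (auto simp: X_def)
  moreover have "(\<lambda>x. h (k x)) ` X \<subseteq> X"
    using close e' IFS_maps[OF h(1)] k_S1 by (fastforce simp: X_def dist_commute)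
  ultimately have "\<exists>!q\<in>X. h (k q) = q"
    using contraction by (intro Banach_fix[where c = "1 / 2"]) auto
  then obtain q where q: "q \<in> X" "h (k q) = q" by blast
  have "dist q y \<le> e' / 2"
    using close[OF q(1)] q(2) by simp
  then have q_y: "dist q y < e'" using e' by linarith
  have "q \<in> S1" using q by (simp add: X_def)
  show thesis
  proof (rule that[of "compose S1 h k" q "1 / 2"])
    show "compose S1 h k \<in> IFS a b" using h k by (intro IFS.comp)
    show "dist q y < e" using q_y e' by simp
    show "compose S1 h k q = q" using q \<open>q \<in> S1\<close> by (simp add: compose_def)
    show "\<exists>\<eta>>0. \<forall>x\<in>S1. dist x q < \<eta> \<longrightarrow> dist (compose S1 h k x) q \<le> 1 / 2 * dist x q"
    proof (intro exI[of _ "e' - dist q y"] conjI ballI impI)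
      fix x :: complex assume x: "x \<in> S1" "dist x q < e' - dist q y"
      then have "x \<in> X"
        using dist_triangle[of x y q] by (simp add: X_def dist_commute)
      with contraction[OF this q(1)] x q(2) show "dist (compose S1 h k x) q \<le> 1 / 2 * dist x q"
        by (simp add: compose_def)
    qed (use q_y in simp)
  qed (use \<open>q \<in> S1\<close> in auto)
qed

end

text \<open>Kronecker's theorem gives density of one orbit.  Compactness makes the number of iterates
  independent of the target, and commutation with rotations makes it independent of the start.\<close>

lemma irrational_rotation_uniformly_dense:
  assumes "\<alpha> \<notin> \<rat>" "e > 0"
  obtains N where "\<And>x z. \<lbrakk>x \<in> S1; z \<in> S1\<rbrakk> \<Longrightarrow>
    \<exists>n. 1 \<le> n \<and> n \<le> N \<and> dist (cis (2 * pi * \<alpha> * real n) * x) z < e"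
proof -
  have "\<exists>n\<ge>1. dist (cis (2 * pi * \<alpha> * real n)) w < e / 2" if w: "w \<in> S1" for w
  proof -
    have w: "w = cis (Arg w)" by (rule circle_eq_cis[OF w])
    have "e / (4 * pi) > 0" using \<open>e > 0\<close> by simp
    then obtain h k :: int where hk: "k > 0" "\<bar>of_int k * \<alpha> - of_int h - Arg w / (2 * pi)\<bar> < e / (4 * pi)"
      using sequence_of_fractional_parts_is_dense[OF \<open>\<alpha> \<notin> \<rat>\<close>] by blast
    define s where "s = 2 * pi * (of_int k * \<alpha> - of_int h)"
    have "real (nat k) = of_int k" using hk(1) by simp
    then have "cis (2 * pi * \<alpha> * real (nat k)) = cis s"
      unfolding cis_eq_iff s_def by (intro exI[of _ h]) (simp add: algebra_simps)
    moreover have "\<bar>s - Arg w\<bar> < e / 2"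
    proof -
      have "s - Arg w = 2 * pi * (of_int k * \<alpha> - of_int h - Arg w / (2 * pi))"
        by (simp add: s_def algebra_simps)
      also have "\<bar>\<dots>\<bar> = 2 * pi * \<bar>of_int k * \<alpha> - of_int h - Arg w / (2 * pi)\<bar>"
        by (simp add: abs_mult)
      also have "\<dots> < 2 * pi * (e / (4 * pi))"
        using hk(2) by (intro mult_strict_left_mono) auto
      also have "\<dots> = e / 2" by simp
      finally show ?thesis .
    qed
    then have "dist (cis s) (cis (Arg w)) < e / 2"
      using dist_cis_le[of s "Arg w"] by linarith
    ultimately show ?thesis
      using hk(1) w by (intro exI[of _ "nat k"]) auto
  qed
  then obtain n where n: "\<And>w. w \<in> S1 \<Longrightarrow> n w \<ge> 1 \<and> dist (cis (2 * pi * \<alpha> * real (n w))) w < e / 2"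
    by metis
  have "S1 \<subseteq> (\<Union>w\<in>S1. ball w (e / 2))"
    using \<open>e > 0\<close> by auto
  then obtain W where W: "W \<subseteq> S1" "finite W" "S1 \<subseteq> (\<Union>w\<in>W. ball w (e / 2))"
    using compactE_image[OF compact_sphere, of S1 "\<lambda>w. ball w (e / 2)"] by (metis open_ball)
  show thesis
  proof (rule that[of "Max (n ` W)"])
    fix x z :: complex assume xz: "x \<in> S1" "z \<in> S1"
    have "x \<noteq> 0" "norm x = 1" using xz by auto
    have "z / x \<in> S1" using xz by (simp add: norm_divide)
    then obtain w where w: "w \<in> W" "dist w (z / x) < e / 2"
      using W(3) by auto
    let ?c = "cis (2 * pi * \<alpha> * real (n w))"
    have "?c * x - z = (?c - z / x) * x"
      using \<open>x \<noteq> 0\<close> by (simp add: field_simps)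
    then have "dist (?c * x) z = dist ?c (z / x)"
      using \<open>norm x = 1\<close> by (simp add: dist_norm norm_mult)
    also have "\<dots> < e"
      using dist_triangle[of ?c "z / x" w] n[of w] w W(1) by auto
    finally show "\<exists>n'. 1 \<le> n' \<and> n' \<le> Max (n ` W) \<and> dist (cis (2 * pi * \<alpha> * real n') * x) z < e"
      using n[of w] w(1) W(1,2) by (intro exI[of _ "n w"]) auto
  qed
qed

lemma iterate_near_rotation:
  assumes maps: "\<And>z. z \<in> S1 \<Longrightarrow> a z \<in> S1"
    and near: "\<And>z. z \<in> S1 \<Longrightarrow> dist (a z) (rotation \<alpha> z) \<le> \<delta>" and "z \<in> S1"
  shows "(a ^^ n) z \<in> S1 \<and> dist ((a ^^ n) z) (cis (2 * pi * \<alpha> * real n) * z) \<le> real n * \<delta>"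
proof (induction n)
  case (Suc n)
  let ?R = "cis (2 * pi * \<alpha>)" and ?y = "(a ^^ n) z" and ?c = "cis (2 * pi * \<alpha> * real n)"
  have "cis (2 * pi * \<alpha> * real (Suc n)) = ?R * ?c"
    by (simp add: cis_mult algebra_simps)
  then have "dist (a ?y) (cis (2 * pi * \<alpha> * real (Suc n)) * z) \<le>
      dist (a ?y) (?R * ?y) + dist (?R * ?y) (?R * (?c * z))"
    by (metis dist_triangle mult.assoc)
  also have "dist (?R * ?y) (?R * (?c * z)) = dist ?y (?c * z)"
    by (simp add: dist_norm norm_mult flip: right_diff_distrib)
  also have "dist (a ?y) (?R * ?y) \<le> \<delta>"
    using near[of ?y] Suc by (simp add: rotation_def)
  finally show ?case
    using Suc maps[of ?y] by (simp add: algebra_simps)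
qed (use \<open>z \<in> S1\<close> in simp)

lemma lipschitz_on_funpow:
  fixes f :: "'a::metric_space \<Rightarrow> 'a"
  assumes "L-lipschitz_on X f" "f ` X \<subseteq> X"
  shows "(L ^ n)-lipschitz_on X (f ^^ n)"
proof (induction n)
  case (Suc n)
  have "(f ^^ n) ` X \<subseteq> X"
    using assms(2) by (induction n) auto
  then have "L-lipschitz_on ((f ^^ n) ` X) f"
    by (rule lipschitz_on_subset[OF assms(1)])
  from lipschitz_on_compose[OF Suc this] show ?case by simp
qed (simp add: lipschitz_on_def)

text \<open>The hypotheses of \<open>blends_imp_contracting_pair\<close>, which are shared by the forward and the backward
  system: \<open>a\<close> is \<open>\<delta>\<close>-close to the rotation, and \<open>b\<close> contracts around \<open>p\<close> and maps a ball around \<open>p\<close>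
  over a ball around \<open>c\<close>.  The contraction takes place on twice the radius, which leaves room
  around every point of the smaller ball.\<close>

definition blends ::
    "real \<Rightarrow> real \<Rightarrow> real \<Rightarrow> real \<Rightarrow> real \<Rightarrow> (complex \<Rightarrow> complex) \<Rightarrow> (complex \<Rightarrow> complex) \<Rightarrow> bool" where
  "blends \<alpha> \<delta> \<nu> r s a b \<longleftrightarrow> bij_betw a S1 S1 \<and> b ` S1 \<subseteq> S1 \<and>
     (\<forall>z\<in>S1. dist (a z) (rotation \<alpha> z) \<le> \<delta>) \<and> (1 + \<delta>)-lipschitz_on S1 a \<and>
     (\<exists>p\<in>S1. \<exists>c\<in>S1. \<nu>-lipschitz_on (S1 \<inter> ball p (2 * r)) b \<and>
       S1 \<inter> ball c s \<subseteq> b ` (S1 \<inter> ball p r))"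

lemma blendsI:
  assumes "bij_betw a S1 S1" "\<And>z. z \<in> S1 \<Longrightarrow> b z \<in> S1" "p \<in> S1" "c \<in> S1"
    "\<And>z. z \<in> S1 \<Longrightarrow> dist (a z) (rotation \<alpha> z) \<le> \<delta>" "(1 + \<delta>)-lipschitz_on S1 a"
    "\<nu>-lipschitz_on (S1 \<inter> ball p (2 * r)) b" "S1 \<inter> ball c s \<subseteq> b ` (S1 \<inter> ball p r)"
  shows "blends \<alpha> \<delta> \<nu> r s a b"
  unfolding blends_def using assms by blast

text \<open>The words are \<open>a\<^sup>n \<circ> b\<close> with \<open>n \<le> N\<close>, where \<open>N\<close> depends only on the angle and on the radii.  So \<open>\<delta>\<close> can
  be chosen after \<open>N\<close>, small enough for the first \<open>N\<close> powers of \<open>a\<close> to follow the rotation and to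
  spoil only part of the contraction of \<open>b\<close>.\<close>

lemma blends_imp_contracting_pair:
  assumes "\<alpha> \<notin> \<rat>" and \<nu>: "0 \<le> \<nu>" "\<nu> < 1" and "r > 0" "s > 0"
  obtains \<delta> where "\<delta> > 0"
    "\<And>a b. blends \<alpha> \<delta> \<nu> r s a b \<Longrightarrow> contracting_pair a b ((1 + \<nu>) / 2) r 2"
proof -
  define e where "e = min (s / 2) (r / 4)"
  have e: "0 < e" "2 * e \<le> s" "2 * e \<le> r / 2"
    using \<open>r > 0\<close> \<open>s > 0\<close> by (auto simp: e_def)
  obtain N where N: "\<And>x z. \<lbrakk>x \<in> S1; z \<in> S1\<rbrakk> \<Longrightarrow>
      \<exists>n. 1 \<le> n \<and> n \<le> N \<and> dist (cis (2 * pi * \<alpha> * real n) * x) z < e"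
    using irrational_rotation_uniformly_dense[OF \<open>\<alpha> \<notin> \<rat>\<close> e(1)] by blast
  \<comment> \<open>The bound exceeds 1, and its product with the contraction rate of b is at most (1 + \<nu>) / 2.\<close>
  have "eventually (\<lambda>d. (1 + d) ^ N < (3 - \<nu>) / 2) (at_right (0::real))"
  proof (rule order_tendstoD)
    show "((\<lambda>d. (1 + d) ^ N) \<longlongrightarrow> (1 + 0) ^ N) (at_right (0::real))"
      by (intro tendsto_intros)
  qed (use \<nu> in simp)
  moreover have "eventually (\<lambda>d::real. d < e / real (Suc N)) (at_right 0)"
    using e(1) by (intro order_tendstoD[OF tendsto_ident_at]) simp
  moreover have "eventually (\<lambda>d::real. 0 < d) (at_right 0)"
    by (simp add: eventually_at_right_less)
  ultimately have "eventually (\<lambda>d. (1 + d) ^ N < (3 - \<nu>) / 2 \<and> d < e / real (Suc N) \<and> 0 < d) (at_right 0)"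
    by eventually_elim simp
  then obtain d where d: "(1 + d) ^ N < (3 - \<nu>) / 2" "d < e / real (Suc N)" "0 < d"
    by (metis (no_types, lifting) eventually_happens' trivial_limit_at_right_real)
  have nd: "real n * d < e" if "n \<le> N" for n
  proof -
    have "real n * d \<le> real (Suc N) * d"
      using that d(3) by (intro mult_right_mono) auto
    also have "\<dots> < e"
      using d(2) by (simp add: field_simps)
    finally show ?thesis .
  qed
  have pow: "(1 + d) ^ n \<le> (3 - \<nu>) / 2" if "n \<le> N" for n
  proof -
    have "(1 + d) ^ n \<le> (1 + d) ^ N"
      using that d(3) by (intro power_increasing) auto
    with d(1) show ?thesis by linarith
  qed
  show thesis
  proof (rule that[OF d(3)])
    fix a b :: "complex \<Rightarrow> complex" assume "blends \<alpha> d \<nu> r s a b"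
    then obtain p c where a: "bij_betw a S1 S1" and "b ` S1 \<subseteq> S1" and pc: "p \<in> S1" "c \<in> S1"
      and near: "\<And>z. z \<in> S1 \<Longrightarrow> dist (a z) (rotation \<alpha> z) \<le> d"
      and lip_a: "(1 + d)-lipschitz_on S1 a" and lip_b: "\<nu>-lipschitz_on (S1 \<inter> ball p (2 * r)) b"
      and onto: "S1 \<inter> ball c s \<subseteq> b ` (S1 \<inter> ball p r)"
      unfolding blends_def by blast
    have b: "b z \<in> S1" if "z \<in> S1" for z
      using \<open>b ` S1 \<subseteq> S1\<close> that by blast
    have maps_a: "a z \<in> S1" if "z \<in> S1" for z
      using a that by (auto simp: bij_betw_def)
    have iter: "dist ((a ^^ n) z) (cis (2 * pi * \<alpha> * real n) * z) \<le> real n * d" if "z \<in> S1" for z n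
      using iterate_near_rotation[of a \<alpha> d z n] maps_a near that by blast
    have lip_iter: "((3 - \<nu>) / 2)-lipschitz_on S1 (a ^^ n)" if "n \<le> N" for n
      by (rule lipschitz_on_mono[OF lipschitz_on_funpow[OF lip_a] order_refl pow[OF that]])
        (use maps_a in auto)
    have power_of_a: "\<exists>h\<in>IFS a b. (\<forall>z\<in>S1. h z = (a ^^ n) z) \<and> ((3 - \<nu>) / 2)-lipschitz_on S1 h"
      if n: "1 \<le> n" "n \<le> N" for n
    proof -
      obtain h where h: "h \<in> IFS a b" "\<And>z. z \<in> S1 \<Longrightarrow> h z = (a ^^ n) z"
        using IFS_iterate[of a b "n - 1"] maps_a n(1) by auto
      moreover have "((3 - \<nu>) / 2)-lipschitz_on S1 h"
        using h(2) by (intro lipschitz_on_transform[OF lip_iter[OF n(2)]]) auto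
      ultimately show ?thesis by blast
    qed
    show "contracting_pair a b ((1 + \<nu>) / 2) r 2"
    proof
      fix y :: complex assume y: "y \<in> S1"
      obtain n where n: "1 \<le> n" "n \<le> N" "dist (cis (2 * pi * \<alpha> * real n) * c) y < e"
        using N[OF pc(2) y] by blast
      have "bij_betw (a ^^ n) S1 S1"
        using a by (rule bij_betw_funpow)
      then obtain v where v: "v \<in> S1" "(a ^^ n) v = y"
        using y by (metis (no_types, lifting) bij_betw_imp_surj_on imageE)
      let ?c = "cis (2 * pi * \<alpha> * real n)"
      \<comment> \<open>The preimage v of y under the n-th power of a is close to c, because the n-th power of the
        rotation takes c close to y and the rotation is an isometry.\<close>
      have "dist v c = dist (?c * v) (?c * c)"
        by (simp add: dist_norm norm_mult flip: right_diff_distrib)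
      also have "\<dots> \<le> dist y (?c * v) + dist (?c * c) y"
        using dist_triangle[of "?c * v" "?c * c" y] by (simp add: dist_commute)
      also have "\<dots> < e + e"
        using iter[OF v(1), of n] v(2) n(3) nd[OF n(2)] by simp
      finally have "dist v c < s" using e(2) by simp
      then obtain u where u: "u \<in> S1" "dist p u < r" "b u = v"
        using onto v(1) by (force simp: dist_commute)
      obtain h where h: "h \<in> IFS a b" "\<And>z. z \<in> S1 \<Longrightarrow> h z = (a ^^ n) z"
          "((3 - \<nu>) / 2)-lipschitz_on S1 h"
        using power_of_a[OF n(1,2)] by blast
      have "ball u r \<subseteq> ball p (2 * r)"
      proof
        fix x assume "x \<in> ball u r"
        then show "x \<in> ball p (2 * r)"
          using u(2) dist_triangle[of p x u] by simp
      qed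
      then have "\<nu>-lipschitz_on (S1 \<inter> ball u r) b"
        by (intro lipschitz_on_subset[OF lip_b]) auto
      moreover have "((3 - \<nu>) / 2)-lipschitz_on (b ` (S1 \<inter> ball u r)) h"
        using b by (intro lipschitz_on_subset[OF h(3)]) auto
      ultimately have "((3 - \<nu>) / 2 * \<nu>)-lipschitz_on (S1 \<inter> ball u r) (h \<circ> b)"
        using lipschitz_on_compose by blast
      moreover have "(3 - \<nu>) / 2 * \<nu> \<le> (1 + \<nu>) / 2"
        using zero_le_power2[of "1 - \<nu>"] by (simp add: power2_eq_square algebra_simps)
      ultimately have "((1 + \<nu>) / 2)-lipschitz_on (S1 \<inter> ball u r) (h \<circ> b)"
        by (rule lipschitz_on_mono[OF _ order_refl])
      then have "((1 + \<nu>) / 2)-lipschitz_on (S1 \<inter> ball u r) (compose S1 h b)"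
        by (rule lipschitz_on_transform) (simp add: compose_def)
      moreover have "compose S1 h b u = y"
        using u v h(2) by (simp add: compose_def)
      ultimately show "\<exists>h\<in>IFS a b. \<exists>u\<in>S1. h u = y \<and> ((1 + \<nu>) / 2)-lipschitz_on (S1 \<inter> ball u r) h"
        using u(1) IFS.comp[OF h(1) IFS.gen2] by blast
    next
      fix x u :: complex assume xu: "x \<in> S1" "u \<in> S1"
      obtain n where n: "1 \<le> n" "n \<le> N" "dist (cis (2 * pi * \<alpha> * real n) * x) u < e"
        using N[OF xu] by blast
      obtain h where h: "h \<in> IFS a b" "\<And>z. z \<in> S1 \<Longrightarrow> h z = (a ^^ n) z"
          "((3 - \<nu>) / 2)-lipschitz_on S1 h"
        using power_of_a[OF n(1,2)] by blast
      have "dist (h x) u \<le> dist ((a ^^ n) x) (cis (2 * pi * \<alpha> * real n) * x)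
          + dist (cis (2 * pi * \<alpha> * real n) * x) u"
        using h(2)[OF xu(1)] by (simp add: dist_triangle)
      also have "\<dots> < e + e"
        using iter[OF xu(1), of n] n(3) nd[OF n(2)] by simp
      finally have "dist (h x) u < r / 2" using e(3) by simp
      moreover have "2-lipschitz_on S1 h"
        using \<nu> by (intro lipschitz_on_mono[OF h(3)]) auto
      ultimately show "\<exists>k\<in>IFS a b. dist (k x) u < r / 2 \<and> 2-lipschitz_on S1 k"
        using h(1) by blast
    qed (use maps_a b \<nu> \<open>r > 0\<close> in auto)
  qed
qed


section \<open>Robustness under perturbations in the \<open>C\<^sup>1\<close>-topology\<close>

lemma circle_deriv_bound:
  assumes "f \<in> Diff1"
  obtains M where "M \<ge> 0" "\<And>z. z \<in> S1 \<Longrightarrow> \<bar>circle_deriv f z\<bar> \<le> M"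
proof -
  obtain M where M: "\<And>z. z \<in> S1 \<Longrightarrow> \<bar>circle_deriv f z\<bar> \<le> M"
    using bounded_circle_deriv[of f] assms unfolding Diff1_def bounded_iff
    by (metis (no_types, lifting) imageI mem_Collect_eq real_norm_def)
  have "0 \<le> M" using M[of 1] by simp
  with M show thesis by (rule that[rotated])
qed

lemma Diff1_lipschitz:
  assumes f: "f \<in> Diff1"
  obtains L where "L > 0" "L-lipschitz_on S1 f"
proof -
  obtain M where M: "M \<ge> 0" "\<And>z. z \<in> S1 \<Longrightarrow> \<bar>circle_deriv f z\<bar> \<le> M"
    using circle_deriv_bound[OF f] by blast
  have "(4 * M + 1)-lipschitz_on S1 f"
  proof (rule lipschitz_onI)
    fix x y :: complex assume xy: "x \<in> S1" "y \<in> S1"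
    obtain t where t: "y = cis t"
      using circle_eq_cis[OF xy(2)] by blast
    obtain s where s: "x = cis s" "\<bar>s - t\<bar> \<le> 4 * dist x (cis t)"
      using arc_le_chord[OF xy(1)] by blast
    have "dist (f x) (f y) \<le> M * \<bar>s - t\<bar>"
      unfolding s(1) t using Diff1_velocity(1)[OF f]
      by (rule bounded_velocity_lipschitz) (use M(2) f in \<open>simp add: norm_mult\<close>)
    also have "\<dots> \<le> M * (4 * dist x y)"
      using s(2) t M(1) by (intro mult_left_mono) auto
    also have "\<dots> \<le> (4 * M + 1) * dist x y"
      by (simp add: algebra_simps)
    finally show "dist (f x) (f y) \<le> (4 * M + 1) * dist x y" .
  qed (use M in simp)
  then show thesis using M by (intro that[of "4 * M + 1"]) auto
qed

lemma circle_inv_cancel: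
  assumes "bij_betw f S1 S1" "z \<in> S1"
  shows "f (circle_inv f z) = z" "circle_inv f (f z) = z" "circle_inv f z \<in> S1"
proof -
  have "f z \<in> S1" "inv_into S1 f z \<in> S1"
    using assms bij_betw_apply[OF assms(1)] bij_betw_apply[OF bij_betw_inv_into[OF assms(1)]] by auto
  then show "f (circle_inv f z) = z" "circle_inv f (f z) = z" "circle_inv f z \<in> S1"
    using assms unfolding circle_inv_def
    by (simp_all add: bij_betw_inv_into_left bij_betw_inv_into_right del: mem_sphere_0)
qed

lemma circle_inv_bij:
  assumes "bij_betw f S1 S1"
  shows "bij_betw (circle_inv f) S1 S1"
proof (rule bij_betw_byWitness[where f' = f])
  show "f ` S1 \<subseteq> S1" using assms by (simp add: bij_betw_def)
qed (use circle_inv_cancel[OF assms] in blast)+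

lemma circle_inv_circle_inv:
  assumes "f \<in> Diff1"
  shows "circle_inv (circle_inv f) = f"
proof
  fix z
  note bij = Diff1_bij[OF assms]
  show "circle_inv (circle_inv f) z = f z"
  proof (cases "z \<in> S1")
    case True
    have "circle_inv f (circle_inv (circle_inv f) z) = circle_inv f (f z)"
      using circle_inv_cancel(1)[OF circle_inv_bij[OF bij] True] circle_inv_cancel(2)[OF bij True] by simp
    then show ?thesis
      using circle_inv_cancel(3)[OF circle_inv_bij[OF bij] True] Diff1_maps[OF assms True]
        circle_inv_cancel(1)[OF bij] by metis
  next
    case False
    then show ?thesis
      using assms by (auto simp: circle_inv_def Diff1_def C1_circle_map_def PiE_def extensional_def)
  qed
qed

lemma circle_inv_Diff1: "f \<in> Diff1 \<Longrightarrow> circle_inv f \<in> Diff1"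
  using circle_inv_bij circle_inv_circle_inv by (simp add: Diff1_def)

lemma Diff1_expansion_bound:
  assumes "f \<in> Diff1"
  obtains L where "L > 0" "\<And>x y. \<lbrakk>x \<in> S1; y \<in> S1\<rbrakk> \<Longrightarrow> dist x y \<le> L * dist (f x) (f y)"
proof -
  obtain L where L: "L > 0" "L-lipschitz_on S1 (circle_inv f)"
    using Diff1_lipschitz[OF circle_inv_Diff1[OF assms]] by blast
  have "dist x y \<le> L * dist (f x) (f y)" if "x \<in> S1" "y \<in> S1" for x y
    using lipschitz_onD[OF L(2) Diff1_maps[OF assms that(1)] Diff1_maps[OF assms that(2)]]
      circle_inv_cancel(2)[OF Diff1_bij[OF assms]] that by simp
  with L(1) show thesis by (rule that)
qed

text \<open>Closeness in the form in which it is used: the last condition bounds the change of all chord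
  lengths.\<close>

definition C1_near :: "real \<Rightarrow> (complex \<Rightarrow> complex) \<Rightarrow> (complex \<Rightarrow> complex) \<Rightarrow> bool" where
  "C1_near \<eta> f g \<longleftrightarrow> f \<in> Diff1 \<and> (\<forall>z\<in>S1. dist (f z) (g z) \<le> \<eta>) \<and>
     (\<forall>z\<in>S1. \<bar>circle_deriv f z - circle_deriv g z\<bar> \<le> \<eta>) \<and> \<eta>-lipschitz_on S1 (\<lambda>z. f z - g z)"

lemma C1_near_mono: "C1_near \<eta> f g \<Longrightarrow> \<eta> \<le> \<eta>' \<Longrightarrow> C1_near \<eta>' f g"
  unfolding C1_near_def using lipschitz_on_mono by (meson order_refl order_trans)

lemma C1_dist_imp_near:
  assumes g: "g \<in> Diff1" and "\<eta> > 0"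
  obtains \<delta> where "\<delta> > 0" "\<And>f. \<lbrakk>f \<in> Diff1; C1_dist g f < \<delta>\<rbrakk> \<Longrightarrow> C1_near \<eta> f g"
proof -
  obtain M where M: "M \<ge> 0" "\<And>z. z \<in> S1 \<Longrightarrow> \<bar>circle_deriv g z\<bar> \<le> M"
    using circle_deriv_bound[OF g] by blast
  define \<delta> where "\<delta> = \<eta> / (4 * (1 + M))"
  have \<delta>: "\<delta> > 0" "4 * (1 + M) * \<delta> = \<eta>"
    using M(1) \<open>\<eta> > 0\<close> by (auto simp: \<delta>_def)
  have "1 * \<delta> \<le> 4 * (1 + M) * \<delta>"
    using M(1) \<delta>(1) by (intro mult_right_mono) auto
  then have "\<delta> \<le> \<eta>" using \<delta>(2) by simp
  show thesis
  proof (rule that[OF \<delta>(1)])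
    fix f assume f: "f \<in> Diff1" and d: "C1_dist g f < \<delta>"
    obtain B where B: "\<And>z. z \<in> S1 \<Longrightarrow> \<bar>circle_deriv f z\<bar> \<le> B"
      using circle_deriv_bound[OF f] by blast
    have bdd1: "bdd_above ((\<lambda>z. dist (g z) (f z)) ` S1)"
    proof (rule bdd_aboveI2)
      fix z :: complex assume "z \<in> S1"
      then have "norm (g z) = 1" "norm (f z) = 1"
        using Diff1_maps f g by auto
      then show "dist (g z) (f z) \<le> 2"
        using norm_triangle_ineq4[of "g z" "f z"] by (simp add: dist_norm)
    qed
    have bdd2: "bdd_above ((\<lambda>z. \<bar>circle_deriv g z - circle_deriv f z\<bar>) ` S1)"
      by (rule bdd_aboveI2[of _ _ "M + B"]) (use M(2) B in fastforce)
    have le1: "dist (g z) (f z) \<le> (SUP z\<in>S1. dist (g z) (f z))" if "z \<in> S1" for z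
      using that by (rule cSUP_upper[OF _ bdd1])
    have le2: "\<bar>circle_deriv g z - circle_deriv f z\<bar> \<le>
        (SUP z\<in>S1. \<bar>circle_deriv g z - circle_deriv f z\<bar>)" if "z \<in> S1" for z
      using that by (rule cSUP_upper[OF _ bdd2])
    have nonneg: "0 \<le> (SUP z\<in>S1. dist (g z) (f z))"
        "0 \<le> (SUP z\<in>S1. \<bar>circle_deriv g z - circle_deriv f z\<bar>)"
      using le1[of 1] le2[of 1] by (auto intro: order_trans[OF zero_le_dist] order_trans[OF abs_ge_zero])
    have dist: "dist (f z) (g z) \<le> \<delta>" and deriv: "\<bar>circle_deriv f z - circle_deriv g z\<bar> \<le> \<delta>"
      if "z \<in> S1" for z
      using le1[OF that] le2[OF that] nonneg d f g
      by (auto simp: C1_dist_def dist_commute abs_minus_commute)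
    have "\<eta>-lipschitz_on S1 (\<lambda>z. f z - g z)"
    proof (rule lipschitz_onI)
      fix x y :: complex assume "x \<in> S1" "y \<in> S1"
      then show "dist (f x - g x) (f y - g y) \<le> \<eta> * dist x y"
        using C1_close_difference_lipschitz[OF f g dist deriv M(2)] \<delta>(2) by simp
    qed (use \<open>\<eta> > 0\<close> in simp)
    then show "C1_near \<eta> f g"
      using f dist deriv \<open>\<delta> \<le> \<eta>\<close> unfolding C1_near_def by force
  qed
qed

lemma C1_near_dist:
  assumes "C1_near \<eta> f g" "x \<in> S1" "y \<in> S1"
  shows "\<bar>dist (f x) (f y) - dist (g x) (g y)\<bar> \<le> \<eta> * dist x y"
proof -
  have "norm ((f x - f y) - (g x - g y)) \<le> \<eta> * dist x y"
    using lipschitz_onD[of \<eta> S1 "\<lambda>z. f z - g z" x y] assms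
    by (simp add: C1_near_def dist_norm algebra_simps)
  then show ?thesis
    using norm_triangle_ineq3[of "f x - f y" "g x - g y"] by (simp add: dist_norm)
qed

lemma dist_rotation:
  assumes "x \<in> S1" "y \<in> S1"
  shows "dist (rotation \<alpha> x) (rotation \<alpha> y) = dist x y"
  using assms by (simp add: rotation_def dist_norm norm_mult flip: right_diff_distrib)

text \<open>The ball that \<open>f2\<close> covers has to be found uniformly in \<open>f2\<close>.  The preimage of a point near \<open>g p\<close>
  under \<open>f2\<close> is mapped by \<open>g\<close> to a point near \<open>g p\<close>, and the inverse of \<open>g\<close> is Lipschitz, so the
  preimage is near \<open>p\<close>.\<close>

lemma forward_contracting:
  assumes "\<alpha> \<notin> \<rat>" and g: "g \<in> Diff1" and p: "p \<in> S1" "\<bar>circle_deriv g p\<bar> < 1"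
  obtains \<eta> where "\<eta> > 0" "\<And>f1 f2. \<lbrakk>C1_near \<eta> f1 (rotation \<alpha>); C1_near \<eta> f2 g\<rbrakk> \<Longrightarrow>
    \<exists>\<mu> r. contracting_pair f1 f2 \<mu> r 2"
proof -
  define e where "e = (1 - \<bar>circle_deriv g p\<bar>) / 3"
  define \<nu> where "\<nu> = \<bar>circle_deriv g p\<bar> + 2 * e"
  have e: "e > 0" and \<nu>: "0 \<le> \<nu>" "\<nu> < 1"
    using p(2) by (auto simp: e_def \<nu>_def field_simps)
  obtain r1 where r1: "r1 > 0" "\<And>x y. \<lbrakk>x \<in> S1; y \<in> S1; dist x p < r1; dist y p < r1\<rbrakk> \<Longrightarrow>
      dist (g x) (g y) \<le> (\<bar>circle_deriv g p\<bar> + e) * dist x y"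
    by (rule circle_deriv_local_stretch[OF g p(1) e]) (rule that)
  obtain L where L: "L > 0" "\<And>x y. \<lbrakk>x \<in> S1; y \<in> S1\<rbrakk> \<Longrightarrow> dist x y \<le> L * dist (g x) (g y)"
    by (rule Diff1_expansion_bound[OF g]) (rule that)
  define r where "r = r1 / 2"
  define s where "s = r / (2 * L)"
  have rs: "r > 0" "s > 0" using r1(1) L(1) by (auto simp: r_def s_def)
  obtain \<delta> where \<delta>: "\<delta> > 0" and contracting:
    "\<And>a b. blends \<alpha> \<delta> \<nu> r s a b \<Longrightarrow> contracting_pair a b ((1 + \<nu>) / 2) r 2"
    by (rule blends_imp_contracting_pair[OF assms(1) \<nu> rs]) (rule that)
  define \<eta> where "\<eta> = min \<delta> (min e s)"
  have \<eta>: "\<eta> > 0" "\<eta> \<le> \<delta>" "\<eta> \<le> e" "\<eta> \<le> s"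
    using \<delta> e rs by (auto simp: \<eta>_def)
  show thesis
  proof (rule that[OF \<eta>(1)])
    fix f1 f2 assume near1: "C1_near \<eta> f1 (rotation \<alpha>)" and near2: "C1_near \<eta> f2 g"
    have f1: "f1 \<in> Diff1" and f2: "f2 \<in> Diff1"
      using near1 near2 by (auto simp: C1_near_def)
    have "contracting_pair f1 f2 ((1 + \<nu>) / 2) r 2"
    proof (rule contracting, rule blendsI[where p = p and c = "g p"])
      show "bij_betw f1 S1 S1" by (rule Diff1_bij[OF f1])
      show "f2 z \<in> S1" if "z \<in> S1" for z by (rule Diff1_maps[OF f2 that])
      show "p \<in> S1" by (rule p(1))
      show "g p \<in> S1" by (rule Diff1_maps[OF g p(1)])
      show "dist (f1 z) (rotation \<alpha> z) \<le> \<delta>" if "z \<in> S1" for z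
        using near1 that \<eta>(2) by (force simp: C1_near_def)
      show "(1 + \<delta>)-lipschitz_on S1 f1"
      proof (rule lipschitz_onI)
        fix x y :: complex assume xy: "x \<in> S1" "y \<in> S1"
        have "\<eta> * dist x y \<le> \<delta> * dist x y"
          using \<eta>(2) by (rule mult_right_mono) simp
        then show "dist (f1 x) (f1 y) \<le> (1 + \<delta>) * dist x y"
          using C1_near_dist[OF near1 xy] dist_rotation[OF xy, of \<alpha>] by (simp add: algebra_simps)
      qed (use \<delta> in simp)
      show "\<nu>-lipschitz_on (S1 \<inter> ball p (2 * r)) f2"
      proof (rule lipschitz_onI)
        fix x y assume xy: "x \<in> S1 \<inter> ball p (2 * r)" "y \<in> S1 \<inter> ball p (2 * r)"
        have "dist (g x) (g y) \<le> (\<bar>circle_deriv g p\<bar> + e) * dist x y"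
          using xy by (intro r1(2)) (auto simp: r_def dist_commute)
        moreover have "\<eta> * dist x y \<le> e * dist x y"
          using \<eta>(3) by (rule mult_right_mono) simp
        ultimately show "dist (f2 x) (f2 y) \<le> \<nu> * dist x y"
          using C1_near_dist[OF near2, of x y] xy by (simp add: \<nu>_def algebra_simps)
      qed (rule \<nu>(1))
      show "S1 \<inter> ball (g p) s \<subseteq> f2 ` (S1 \<inter> ball p r)"
      proof
        fix v assume v: "v \<in> S1 \<inter> ball (g p) s"
        define u where "u = circle_inv f2 v"
        have u: "u \<in> S1" "f2 u = v"
          using v circle_inv_cancel[OF Diff1_bij[OF f2]] by (auto simp: u_def)
        have "dist (g p) (g u) \<le> dist (g p) v + dist (f2 u) (g u)"
          unfolding u(2) by (rule dist_triangle)
        also have "\<dots> < s + s"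
          using v near2 u(1) \<eta>(4) by (intro add_less_le_mono) (force simp: C1_near_def)+
        finally have "L * dist (g p) (g u) < L * (s + s)"
          using L(1) by (rule mult_strict_left_mono)
        then have "dist p u < r"
          using L(2)[OF p(1) u(1)] L(1) by (simp add: s_def)
        with u show "v \<in> f2 ` (S1 \<inter> ball p r)" by force
      qed
    qed
    then show "\<exists>\<mu> r. contracting_pair f1 f2 \<mu> r 2" by blast
  qed
qed

text \<open>The inverse of \<open>f2\<close> contracts around \<open>g q\<close>, where \<open>g\<close> expands at \<open>q\<close>.  Closeness of \<open>f2\<close> to \<open>g\<close> is
  transferred to the inverses by comparing images instead of preimages, which avoids the continuity
  of inversion in the \<open>C\<^sup>1\<close>-topology.\<close>

lemma backward_contracting:
  assumes "\<alpha> \<notin> \<rat>" and g: "g \<in> Diff1" and q: "q \<in> S1" "\<bar>circle_deriv g q\<bar> > 1"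
  obtains \<eta> where "\<eta> > 0" "\<And>f1 f2. \<lbrakk>C1_near \<eta> f1 (rotation \<alpha>); C1_near \<eta> f2 g\<rbrakk> \<Longrightarrow>
    \<exists>\<mu> r. contracting_pair (circle_inv f1) (circle_inv f2) \<mu> r 2"
proof -
  define e where "e = (\<bar>circle_deriv g q\<bar> - 1) / 3"
  define m where "m = \<bar>circle_deriv g q\<bar> - 2 * e"
  have e: "e > 0" and m: "m > 1"
    using q(2) by (auto simp: e_def m_def field_simps)
  define \<nu> where "\<nu> = 1 / m"
  have \<nu>: "0 \<le> \<nu>" "\<nu> < 1" using m by (auto simp: \<nu>_def)
  obtain r2 where r2: "r2 > 0" "\<And>x y. \<lbrakk>x \<in> S1; y \<in> S1; dist x q < r2; dist y q < r2\<rbrakk> \<Longrightarrow>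
      (\<bar>circle_deriv g q\<bar> - e) * dist x y \<le> dist (g x) (g y)"
    by (rule circle_deriv_local_stretch[OF g q(1) e]) (rule that)
  obtain L where L: "L > 0" "\<And>x y. \<lbrakk>x \<in> S1; y \<in> S1\<rbrakk> \<Longrightarrow> dist x y \<le> L * dist (g x) (g y)"
    by (rule Diff1_expansion_bound[OF g]) (rule that)
  obtain K where K: "K > 0" "K-lipschitz_on S1 g"
    using Diff1_lipschitz[OF g] by blast
  define r where "r = r2 / (4 * L)"
  define s where "s = r / (2 * K)"
  have rs: "r > 0" "s > 0" using r2(1) L(1) K(1) by (auto simp: r_def s_def)
  have "- \<alpha> \<notin> \<rat>" using assms(1) by simp
  obtain \<delta> where \<delta>: "\<delta> > 0" and contracting:
    "\<And>a b. blends (- \<alpha>) \<delta> \<nu> r s a b \<Longrightarrow> contracting_pair a b ((1 + \<nu>) / 2) r 2"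
    by (rule blends_imp_contracting_pair[OF \<open>- \<alpha> \<notin> \<rat>\<close> \<nu> rs]) (rule that)
  define \<eta> where "\<eta> = min (\<delta> / (1 + \<delta>)) (min e (r / 2))"
  have "\<eta> > 0" using \<delta> e rs by (simp add: \<eta>_def)
  moreover have "\<eta> \<le> \<delta> / (1 + \<delta>)" "\<eta> \<le> e" "\<eta> \<le> r / 2"
    unfolding \<eta>_def by linarith+
  ultimately have \<eta>: "\<eta> > 0" "\<eta> \<le> \<delta> / (1 + \<delta>)" "\<eta> \<le> e" "\<eta> \<le> r / 2" .
  \<comment> \<open>This is 1 / (1 - \<eta>) <= 1 + \<delta>, the Lipschitz constant needed for the inverse of f1.\<close>
  have \<eta>_\<delta>: "(1 + \<delta>) * \<eta> \<le> \<delta>"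
    using \<eta>(2) \<delta> by (simp add: field_simps)
  have "\<eta> \<le> \<delta>"
  proof -
    have "0 \<le> \<delta> * \<eta>" using \<delta> \<eta>(1) by simp
    with \<eta>_\<delta> show ?thesis by (simp add: algebra_simps)
  qed
  show thesis
  proof (rule that[OF \<eta>(1)])
    fix f1 f2 assume near1: "C1_near \<eta> f1 (rotation \<alpha>)" and near2: "C1_near \<eta> f2 g"
    have f1: "f1 \<in> Diff1" and f2: "f2 \<in> Diff1"
      using near1 near2 by (auto simp: C1_near_def)
    note inv1 = circle_inv_cancel[OF Diff1_bij[OF f1]]
    note inv2 = circle_inv_cancel[OF Diff1_bij[OF f2]]
    have close1: "dist (f1 z) (rotation \<alpha> z) \<le> \<eta>" and close2: "dist (f2 z) (g z) \<le> \<eta>" if "z \<in> S1" for z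
      using near1 near2 that by (auto simp: C1_near_def)
    have "contracting_pair (circle_inv f1) (circle_inv f2) ((1 + \<nu>) / 2) r 2"
    proof (rule contracting, rule blendsI[where p = "g q" and c = q])
      show "bij_betw (circle_inv f1) S1 S1" by (rule circle_inv_bij[OF Diff1_bij[OF f1]])
      show "circle_inv f2 z \<in> S1" if "z \<in> S1" for z by (rule inv2(3)[OF that])
      show "g q \<in> S1" by (rule Diff1_maps[OF g q(1)])
      show "q \<in> S1" by (rule q(1))
      show "dist (circle_inv f1 z) (rotation (- \<alpha>) z) \<le> \<delta>" if z: "z \<in> S1" for z
      proof -
        define w where "w = circle_inv f1 z"
        have w: "w \<in> S1" "f1 w = z" using inv1 z by (auto simp: w_def)
        have "z = cis (2 * pi * \<alpha>) * rotation (- \<alpha>) z"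
          using z by (simp add: rotation_def cis_mult flip: mult.assoc)
        then have "dist (rotation \<alpha> w) z = dist (cis (2 * pi * \<alpha>) * w) (cis (2 * pi * \<alpha>) * rotation (- \<alpha>) z)"
          using w(1) by (simp add: rotation_def)
        also have "\<dots> = dist w (rotation (- \<alpha>) z)"
          by (simp add: dist_norm norm_mult flip: right_diff_distrib)
        finally show ?thesis
          using close1[OF w(1)] w(2) \<open>\<eta> \<le> \<delta>\<close> by (simp add: w_def dist_commute)
      qed
      show "(1 + \<delta>)-lipschitz_on S1 (circle_inv f1)"
      proof (rule lipschitz_onI)
        fix x y :: complex assume xy: "x \<in> S1" "y \<in> S1"
        define d where "d = dist (circle_inv f1 x) (circle_inv f1 y)"
        have "d - \<eta> * d \<le> dist x y"
          using C1_near_dist[OF near1, of "circle_inv f1 x" "circle_inv f1 y"] inv1 xy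
            dist_rotation[of "circle_inv f1 x" "circle_inv f1 y" \<alpha>]
          by (simp add: d_def del: mem_sphere_0)
        then have "(1 + \<delta>) * (d - \<eta> * d) \<le> (1 + \<delta>) * dist x y"
          using \<delta> by (intro mult_left_mono) auto
        moreover have "(1 + \<delta>) * \<eta> * d \<le> \<delta> * d"
          using \<eta>_\<delta> by (rule mult_right_mono) (simp add: d_def)
        ultimately show "dist (circle_inv f1 x) (circle_inv f1 y) \<le> (1 + \<delta>) * dist x y"
          unfolding d_def[symmetric] by (simp add: algebra_simps)
      qed (use \<delta> in simp)
      have inv_near: "dist (circle_inv f2 x) q < r2" if x: "x \<in> S1 \<inter> ball (g q) (2 * r)" for x
      proof -
        define w where "w = circle_inv f2 x"
        have w: "w \<in> S1" "f2 w = x" using inv2 x by (auto simp: w_def)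
        have "dist (g w) (g q) \<le> dist (f2 w) (g w) + dist x (g q)"
          using dist_triangle3[of "g w" "g q" x] by (simp add: w(2))
        also have "\<dots> < r / 2 + 2 * r"
          using close2[OF w(1)] \<eta>(4) x by (intro add_le_less_mono) (auto simp: dist_commute)
        finally have "L * dist (g w) (g q) < L * (r / 2 + 2 * r)"
          using L(1) by (rule mult_strict_left_mono)
        also have "\<dots> = 5 / 8 * r2"
          using L(1) by (simp add: r_def)
        finally show ?thesis
          using L(2)[OF w(1) q(1)] r2(1) by (simp add: w_def)
      qed
      show "\<nu>-lipschitz_on (S1 \<inter> ball (g q) (2 * r)) (circle_inv f2)"
      proof (rule lipschitz_onI)
        fix x y assume xy: "x \<in> S1 \<inter> ball (g q) (2 * r)" "y \<in> S1 \<inter> ball (g q) (2 * r)"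
        define v w where "v = circle_inv f2 x" and "w = circle_inv f2 y"
        have vw: "v \<in> S1" "w \<in> S1" "f2 v = x" "f2 w = y"
          using inv2 xy by (auto simp: v_def w_def simp del: mem_sphere_0)
        have "(\<bar>circle_deriv g q\<bar> - e) * dist v w \<le> dist (g v) (g w)"
          using vw inv_near xy by (intro r2(2)) (auto simp: v_def w_def)
        moreover have "\<eta> * dist v w \<le> e * dist v w"
          using \<eta>(3) by (rule mult_right_mono) simp
        ultimately have "m * dist v w \<le> dist x y"
          using C1_near_dist[OF near2 vw(1,2)] vw(3,4) by (simp add: m_def algebra_simps)
        then show "dist (circle_inv f2 x) (circle_inv f2 y) \<le> \<nu> * dist x y"
          using m by (simp add: \<nu>_def v_def w_def field_simps)
      qed (rule \<nu>(1))
      show "S1 \<inter> ball q s \<subseteq> circle_inv f2 ` (S1 \<inter> ball (g q) r)"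
      proof
        fix v assume v: "v \<in> S1 \<inter> ball q s"
        have "dist (g q) (g v) \<le> K * dist q v"
          using v q(1) by (intro lipschitz_onD[OF K(2)]) auto
        also have "\<dots> < K * s"
          using v K(1) by (intro mult_strict_left_mono) auto
        also have "\<dots> = r / 2" using K(1) by (simp add: s_def)
        finally have "dist (g q) (f2 v) < r"
          using close2[of v] v \<eta>(4) dist_triangle[of "g q" "f2 v" "g v"] by (simp add: dist_commute)
        moreover have "f2 v \<in> S1" "circle_inv f2 (f2 v) = v"
          using v Diff1_maps[OF f2] inv2(2) by auto
        ultimately show "v \<in> circle_inv f2 ` (S1 \<inter> ball (g q) r)"
          by (metis IntI image_eqI mem_ball)
      qed
    qed
    then show "\<exists>\<mu> r. contracting_pair (circle_inv f1) (circle_inv f2) \<mu> r 2" by blast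
  qed
qed


section \<open>Periodic points and orbital branches\<close>

abbreviation choose_map :: "('a \<Rightarrow> 'a) \<Rightarrow> ('a \<Rightarrow> 'a) \<Rightarrow> nat \<Rightarrow> 'a \<Rightarrow> 'a" where
  "choose_map f1 f2 i \<equiv> if i = 1 then f1 else f2"

lemma fold_choose_map_maps:
  assumes "f1 ` S1 \<subseteq> S1" "f2 ` S1 \<subseteq> S1" "z \<in> S1"
  shows "fold (choose_map f1 f2) w z \<in> S1"
  using assms(3)
proof (induction w arbitrary: z)
  case (Cons i w)
  have "choose_map f1 f2 i z \<in> S1"
    using assms(1,2) Cons.prems by (simp add: image_subset_iff del: mem_sphere mem_sphere_0)
  then show ?case using Cons.IH by simp
qed simp

lemma IFS_word:
  assumes maps: "f1 ` S1 \<subseteq> S1" "f2 ` S1 \<subseteq> S1" and "h \<in> IFS f1 f2"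
  shows "\<exists>w. set w \<subseteq> {1, 2} \<and> (\<forall>z\<in>S1. h z = fold (choose_map f1 f2) w z)"
  using assms(3)
proof (induction rule: IFS.induct)
  case gen1
  show ?case by (intro exI[of _ "[1]"]) simp
next
  case gen2
  show ?case by (intro exI[of _ "[2]"]) simp
next
  case (comp h k)
  then obtain v w where v: "set v \<subseteq> {1, 2}" "\<forall>z\<in>S1. h z = fold (choose_map f1 f2) v z"
    and w: "set w \<subseteq> {1, 2}" "\<forall>z\<in>S1. k z = fold (choose_map f1 f2) w z" by blast
  have "compose S1 h k z = fold (choose_map f1 f2) (w @ v) z" if "z \<in> S1" for z
    using that v(2) w(2) fold_choose_map_maps[OF maps that, of w] by (simp add: compose_def)
  with v(1) w(1) show ?case by (intro exI[of _ "w @ v"]) auto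
qed

lemma IFS_inverse:
  assumes f1: "f1 \<in> Diff1" and f2: "f2 \<in> Diff1" and h: "h \<in> IFS (circle_inv f1) (circle_inv f2)"
  shows "\<exists>k\<in>IFS f1 f2. \<forall>z\<in>S1. k (h z) = z \<and> h (k z) = z"
  using h
proof (induction rule: IFS.induct)
  case gen1
  show ?case
    using circle_inv_cancel[OF Diff1_bij[OF f1]] by (intro bexI[of _ f1] IFS.gen1) blast
next
  case gen2
  show ?case
    using circle_inv_cancel[OF Diff1_bij[OF f2]] by (intro bexI[of _ f2] IFS.gen2) blast
next
  case (comp h h')
  obtain k k' where k: "k \<in> IFS f1 f2" "\<forall>z\<in>S1. k (h z) = z \<and> h (k z) = z"
    and k': "k' \<in> IFS f1 f2" "\<forall>z\<in>S1. k' (h' z) = z \<and> h' (k' z) = z"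
    using comp.IH by blast
  have "k z \<in> S1" if "z \<in> S1" for z
    using IFS_closed_on_circle[OF k(1)] Diff1_maps f1 f2 that by blast
  moreover have "h' z \<in> S1" if "z \<in> S1" for z
    using IFS_closed_on_circle[OF comp.hyps(2)] circle_inv_cancel(3) Diff1_bij f1 f2 that by blast
  ultimately have "\<forall>z\<in>S1. compose S1 k' k (compose S1 h h' z) = z \<and> compose S1 h h' (compose S1 k' k z) = z"
    using k(2) k'(2) IFS_closed_on_circle[OF comp.hyps(1)] circle_inv_cancel(3) Diff1_bij f1 f2
      IFS_closed_on_circle[OF k'(1)] Diff1_maps
    by (simp add: compose_def del: mem_sphere_0)
  with IFS.comp[OF k'(1) k(1)] show ?case by blast
qed

text \<open>Elements of the semigroup are shown to be differentiable through their lifts, because the chain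
  rule for circle maps themselves would require reparametrizing the inner map.\<close>

lemma IFS_lift:
  assumes f1: "f1 \<in> Diff1" and f2: "f2 \<in> Diff1" and h: "h \<in> IFS f1 f2"
  shows "\<exists>H. (\<forall>t. \<exists>D. (H has_real_derivative D) (at t)) \<and> (\<forall>t. h (cis t) = cis (H t))"
  using h
proof (induction rule: IFS.induct)
  case gen1
  show ?case using Diff1_lift[OF f1] by metis
next
  case gen2
  show ?case using Diff1_lift[OF f2] by metis
next
  case (comp h k)
  obtain H where H: "\<forall>t. \<exists>D. (H has_real_derivative D) (at t)" "\<forall>t. h (cis t) = cis (H t)"
    using comp.IH(1) by blast
  obtain K where K: "\<forall>t. \<exists>D. (K has_real_derivative D) (at t)" "\<forall>t. k (cis t) = cis (K t)"
    using comp.IH(2) by blast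
  have "\<exists>D. ((\<lambda>t. H (K t)) has_real_derivative D) (at t)" for t
    using H(1) K(1) DERIV_chain2 by blast
  moreover have "compose S1 h k (cis t) = cis (H (K t))" for t
    using H(2) K(2) by (simp add: compose_def)
  ultimately show ?case by blast
qed

lemma lift_velocity:
  assumes "(H has_real_derivative D) (at t)"
  shows "((\<lambda>t. cis (H t)) has_vector_derivative of_real D * (\<i> * cis (H t))) (at t)"
proof -
  have "(H has_vector_derivative D) (at t)"
    using assms by (simp add: has_real_derivative_iff_has_vector_derivative)
  from vector_diff_chain_at[OF this has_vector_derivative_cis]
  show ?thesis by (simp add: o_def scaleR_conv_of_real)
qed

lemma circle_deriv_eq_lift_deriv:
  assumes "(H has_real_derivative D) (at t)" "\<And>t. h (cis t) = cis (H t)"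
  shows "circle_deriv h (cis t) = D"
proof -
  have "((\<lambda>s. t + s) has_vector_derivative 1) (at 0)"
    by (auto intro!: derivative_eq_intros)
  moreover have "((\<lambda>t. cis (H t)) has_vector_derivative of_real D * (\<i> * cis (H t))) (at (t + 0))"
    using lift_velocity[OF assms(1)] by simp
  ultimately have "(((\<lambda>t. cis (H t)) \<circ> (\<lambda>s. t + s)) has_vector_derivative
      1 *\<^sub>R (of_real D * (\<i> * cis (H t)))) (at 0)"
    by (rule vector_diff_chain_at)
  then have "((\<lambda>s. h (cis t * cis s)) has_vector_derivative of_real D * (\<i> * cis (H t))) (at 0)"
    by (simp add: o_def cis_mult assms(2))
  then show ?thesis
    by (simp add: circle_deriv_def vector_derivative_at assms(2))
qed

text \<open>The next lemmas compare the derivative at a point with Lipschitz bounds for chords, by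
  writing it as a limit of quotients of chords by arcs.\<close>

lemma speed_as_limit:
  fixes \<gamma> :: "real \<Rightarrow> complex"
  assumes "(\<gamma> has_vector_derivative v) (at t0)"
  shows "((\<lambda>t. dist (\<gamma> t) (\<gamma> t0) / \<bar>t - t0\<bar>) \<longlongrightarrow> norm v) (at t0)"
proof -
  have lim: "((\<lambda>t. (\<gamma> t - \<gamma> t0 - (t - t0) *\<^sub>R v) /\<^sub>R norm (t - t0)) \<longlongrightarrow> 0) (at t0)"
    using assms by (simp add: has_vector_derivative_def has_derivative_at_within)
  have bound: "norm (dist (\<gamma> t) (\<gamma> t0) / \<bar>t - t0\<bar> - norm v) \<le>
      norm ((\<gamma> t - \<gamma> t0 - (t - t0) *\<^sub>R v) /\<^sub>R norm (t - t0))" if "t \<noteq> t0" for t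
  proof -
    have "dist (\<gamma> t) (\<gamma> t0) / \<bar>t - t0\<bar> - norm v =
        (norm (\<gamma> t - \<gamma> t0) - norm ((t - t0) *\<^sub>R v)) / \<bar>t - t0\<bar>"
      using that by (simp add: dist_norm diff_divide_distrib)
    then have "norm (dist (\<gamma> t) (\<gamma> t0) / \<bar>t - t0\<bar> - norm v) =
        \<bar>norm (\<gamma> t - \<gamma> t0) - norm ((t - t0) *\<^sub>R v)\<bar> / \<bar>t - t0\<bar>"
      by simp
    also have "\<dots> \<le> norm (\<gamma> t - \<gamma> t0 - (t - t0) *\<^sub>R v) / \<bar>t - t0\<bar>"
      by (intro divide_right_mono norm_triangle_ineq3) auto
    finally show ?thesis by (simp add: divide_inverse mult.commute)
  qed
  have "((\<lambda>t. dist (\<gamma> t) (\<gamma> t0) / \<bar>t - t0\<bar> - norm v) \<longlongrightarrow> 0) (at t0)"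
    by (rule Lim_null_comparison[OF _ tendsto_norm_zero[OF lim]])
      (use bound in \<open>simp add: eventually_at_filter\<close>)
  then show ?thesis by (simp add: LIM_zero_iff)
qed

lemma circle_deriv_limit:
  assumes f: "f1 \<in> Diff1" "f2 \<in> Diff1" "h \<in> IFS f1 f2"
  shows "((\<lambda>t. dist (h (cis t)) (h (cis t0)) / \<bar>t - t0\<bar>) \<longlongrightarrow> \<bar>circle_deriv h (cis t0)\<bar>) (at t0)"
    and "((\<lambda>t. dist (cis t) (cis t0) / \<bar>t - t0\<bar>) \<longlongrightarrow> 1) (at t0)"
proof -
  obtain H D where H: "(H has_real_derivative D) (at t0)" "\<And>t. h (cis t) = cis (H t)"
    using IFS_lift[OF f] by metis
  show "((\<lambda>t. dist (h (cis t)) (h (cis t0)) / \<bar>t - t0\<bar>) \<longlongrightarrow> \<bar>circle_deriv h (cis t0)\<bar>) (at t0)"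
    using speed_as_limit[OF lift_velocity[OF H(1)]]
    by (simp add: H(2) circle_deriv_eq_lift_deriv[OF H] norm_mult)
  show "((\<lambda>t. dist (cis t) (cis t0) / \<bar>t - t0\<bar>) \<longlongrightarrow> 1) (at t0)"
    using speed_as_limit[OF has_vector_derivative_cis, of t0] by (simp add: norm_mult)
qed

lemma circle_deriv_le_local_lipschitz:
  assumes f: "f1 \<in> Diff1" "f2 \<in> Diff1" "h \<in> IFS f1 f2" and "q \<in> S1" "\<eta> > 0"
    and lip: "\<And>x. \<lbrakk>x \<in> S1; dist x q < \<eta>\<rbrakk> \<Longrightarrow> dist (h x) (h q) \<le> L * dist x q"
  shows "\<bar>circle_deriv h q\<bar> \<le> L"
proof -
  obtain t0 where q: "q = cis t0" using circle_eq_cis[OF \<open>q \<in> S1\<close>] by blast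
  have lim: "((\<lambda>t. L * (dist (cis t) (cis t0) / \<bar>t - t0\<bar>)) \<longlongrightarrow> L * 1) (at t0)"
    by (intro tendsto_intros circle_deriv_limit(2)[OF f])
  have "eventually (\<lambda>t. dist (h (cis t)) (h (cis t0)) / \<bar>t - t0\<bar> \<le>
      L * (dist (cis t) (cis t0) / \<bar>t - t0\<bar>)) (at t0)"
    unfolding eventually_at
  proof (intro exI[of _ \<eta>] conjI ballI impI)
    fix t assume "t \<noteq> t0 \<and> dist t t0 < \<eta>"
    then have "dist (h (cis t)) (h (cis t0)) \<le> L * dist (cis t) (cis t0)"
      using lip[of "cis t"] dist_cis_le[of t t0] by (simp add: q dist_real_def)
    then show "dist (h (cis t)) (h (cis t0)) / \<bar>t - t0\<bar> \<le> L * (dist (cis t) (cis t0) / \<bar>t - t0\<bar>)"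
      by (simp add: divide_right_mono)
  qed (rule \<open>\<eta> > 0\<close>)
  from tendsto_le[OF _ lim circle_deriv_limit(1)[OF f] this] show ?thesis
    unfolding q by simp
qed

lemma circle_deriv_ge_local_expansion:
  assumes f: "f1 \<in> Diff1" "f2 \<in> Diff1" "h \<in> IFS f1 f2" and "q \<in> S1" "\<eta> > 0"
    and exp: "\<And>x. \<lbrakk>x \<in> S1; dist (h x) (h q) < \<eta>\<rbrakk> \<Longrightarrow> dist x q \<le> L * dist (h x) (h q)"
  shows "1 \<le> L * \<bar>circle_deriv h q\<bar>"
proof -
  obtain t0 where q: "q = cis t0" using circle_eq_cis[OF \<open>q \<in> S1\<close>] by blast
  obtain H D where H: "(H has_real_derivative D) (at t0)" "\<And>t. h (cis t) = cis (H t)"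
    using IFS_lift[OF f] by metis
  have lim: "((\<lambda>t. L * (dist (h (cis t)) (h (cis t0)) / \<bar>t - t0\<bar>)) \<longlongrightarrow>
      L * \<bar>circle_deriv h (cis t0)\<bar>) (at t0)"
    by (intro tendsto_intros circle_deriv_limit(1)[OF f])
  have "(\<lambda>t. cis (H t)) \<midarrow>t0\<rightarrow> cis (H t0)"
    using has_vector_derivative_continuous[OF lift_velocity[OF H(1)]] by (simp add: continuous_at)
  then have "eventually (\<lambda>t. dist (h (cis t)) (h (cis t0)) < \<eta>) (at t0)"
    unfolding H(2) using \<open>\<eta> > 0\<close> by (rule tendstoD)
  then have "eventually (\<lambda>t. dist (cis t) (cis t0) / \<bar>t - t0\<bar> \<le>
      L * (dist (h (cis t)) (h (cis t0)) / \<bar>t - t0\<bar>)) (at t0)"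
  proof eventually_elim
    case (elim t)
    then have "dist (cis t) (cis t0) \<le> L * dist (h (cis t)) (h (cis t0))"
      using exp[of "cis t"] by (simp add: q)
    then show ?case by (simp add: divide_right_mono)
  qed
  from tendsto_le[OF _ lim circle_deriv_limit(2)[OF f] this] show ?thesis
    unfolding q by simp
qed

lemma dense_attracting_periodic_points:
  assumes f: "f1 \<in> Diff1" "f2 \<in> Diff1" and "contracting_pair f1 f2 \<mu> r K"
  shows "dense_in_circle (attracting_periodic_points f1 f2)"
proof (rule dense_in_circleI)
  interpret contracting_pair f1 f2 \<mu> r K by fact
  show "attracting_periodic_points f1 f2 \<subseteq> S1"
    by (auto simp: attracting_periodic_points_def)
  fix y :: complex and e :: real assume "y \<in> S1" "e > 0"
  then obtain h q L where h: "h \<in> IFS f1 f2" "q \<in> S1" "dist q y < e" "h q = q" "L < 1"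
    and "\<exists>\<eta>>0. \<forall>x\<in>S1. dist x q < \<eta> \<longrightarrow> dist (h x) q \<le> L * dist x q"
    by (rule attracting_fixed_point)
  then obtain \<eta> where "\<eta> > 0" "\<And>x. \<lbrakk>x \<in> S1; dist x q < \<eta>\<rbrakk> \<Longrightarrow> dist (h x) (h q) \<le> L * dist x q"
    by auto
  then have "\<bar>circle_deriv h q\<bar> \<le> L"
    by (rule circle_deriv_le_local_lipschitz[OF f h(1,2)])
  with h show "\<exists>x\<in>attracting_periodic_points f1 f2. dist x y < e"
    by (auto simp: attracting_periodic_points_def intro!: bexI[of _ q] bexI[of _ h])
qed

text \<open>A word in the inverse maps with an attracting fixed point is the inverse of a word in the maps,
  which expands around the same point.\<close>

lemma dense_repelling_periodic_points:
  assumes f: "f1 \<in> Diff1" "f2 \<in> Diff1"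
    and "contracting_pair (circle_inv f1) (circle_inv f2) \<mu> r K"
  shows "dense_in_circle (repelling_periodic_points f1 f2)"
proof (rule dense_in_circleI)
  interpret contracting_pair "circle_inv f1" "circle_inv f2" \<mu> r K by fact
  show "repelling_periodic_points f1 f2 \<subseteq> S1"
    by (auto simp: repelling_periodic_points_def)
  fix y :: complex and e :: real assume "y \<in> S1" "e > 0"
  then obtain h q L where h: "h \<in> IFS (circle_inv f1) (circle_inv f2)" "q \<in> S1" "dist q y < e"
      "h q = q" "L < 1" "\<exists>\<eta>>0. \<forall>x\<in>S1. dist x q < \<eta> \<longrightarrow> dist (h x) q \<le> L * dist x q"
    by (rule attracting_fixed_point)
  then obtain \<eta> where \<eta>: "\<eta> > 0" "\<And>x. \<lbrakk>x \<in> S1; dist x q < \<eta>\<rbrakk> \<Longrightarrow> dist (h x) q \<le> L * dist x q"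
    by auto
  obtain k where k: "k \<in> IFS f1 f2" "\<forall>z\<in>S1. k (h z) = z \<and> h (k z) = z"
    using IFS_inverse[OF f h(1)] by blast
  have "k q = q" using k(2) h(2,4) by metis
  have expand: "1 \<le> L * \<bar>circle_deriv k q\<bar>"
  proof (rule circle_deriv_ge_local_expansion[OF f k(1) h(2) \<eta>(1)])
    fix x :: complex assume x: "x \<in> S1" "dist (k x) (k q) < \<eta>"
    have "k x \<in> S1"
      using IFS_closed_on_circle[OF k(1)] Diff1_maps f x(1) by blast
    then have "dist (h (k x)) q \<le> L * dist (k x) q"
      using x(2) \<open>k q = q\<close> by (intro \<eta>(2)) auto
    then show "dist x q \<le> L * dist (k x) (k q)"
      using k(2) x(1) \<open>k q = q\<close> by simp
  qed
  have "\<bar>circle_deriv k q\<bar> > 1"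
  proof (rule ccontr)
    assume le_1: "\<not> \<bar>circle_deriv k q\<bar> > 1"
    have "L \<ge> 0"
      using expand mult_nonpos_nonneg[of L "\<bar>circle_deriv k q\<bar>"] by linarith
    then have "L * \<bar>circle_deriv k q\<bar> \<le> L * 1"
      using le_1 by (intro mult_left_mono) auto
    with expand h(5) show False by simp
  qed
  with k(1) h(2,3) \<open>k q = q\<close> show "\<exists>x\<in>repelling_periodic_points f1 f2. dist x y < e"
    by (auto simp: repelling_periodic_points_def intro!: bexI[of _ q] bexI[of _ k])
qed

lemma shift_funpow: "(shift ^^ n) \<omega> j = \<omega> (n + j)"
  by (induction n arbitrary: j) (auto simp: shift_def)

lemma dense_shift_orbit_contains_word:
  assumes "dense_shift_orbit \<omega>" "set w \<subseteq> {1, 2}"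
  obtains n where "\<And>j. j < length w \<Longrightarrow> \<omega> (n + j) = w ! j"
proof -
  define C :: "(nat \<Rightarrow> nat) set" where
    "C = PiE UNIV (\<lambda>j. if j < length w then {w ! j} else {1, 2})"
  define \<sigma> where "\<sigma> = (\<lambda>j. if j < length w then w ! j else 1)"
  have "openin Sigma2_topology C"
    unfolding Sigma2_topology_def C_def openin_PiE_gen
  proof (intro disjI2 conjI ballI)
    show "finite {i \<in> UNIV. (if i < length w then {w ! i} else {1, 2}) \<noteq>
        topspace (discrete_topology {1, 2 :: nat})}"
      by (rule finite_subset[of _ "{..<length w}"]) auto
  qed (use assms(2) nth_mem in auto)
  moreover have "\<sigma> \<in> C"
    by (auto simp: C_def \<sigma>_def)
  moreover have "\<sigma> \<in> Sigma2"
    using assms(2) nth_mem by (auto simp: Sigma2_eq \<sigma>_def)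
  ultimately obtain n where "(shift ^^ n) \<omega> \<in> C"
    using assms(1) unfolding dense_shift_orbit_def by (auto simp: set_eq_iff in_closure_of)
  then have "\<omega> (n + j) = w ! j" if "j < length w" for j
    using that unfolding C_def by (auto simp: PiE_def Pi_def shift_funpow dest: spec[of _ j])
  then show thesis by (rule that)
qed

lemma branch_follows_word:
  assumes "\<And>j. j < length w \<Longrightarrow> \<omega> (n + j) = w ! j" "k \<le> length w"
  shows "branch f1 f2 \<omega> (n + k) x = fold (choose_map f1 f2) (take k w) (branch f1 f2 \<omega> n x)"
  using assms(2)
proof (induction k)
  case (Suc k)
  then show ?case using assms(1)[of k] by (simp add: take_Suc_conv_app_nth)
qed simp

lemma branch_on_circle:
  assumes "f1 \<in> Diff1" "f2 \<in> Diff1" "x \<in> S1"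
  shows "branch f1 f2 \<omega> n x \<in> S1"
proof (induction n)
  case (Suc n)
  then show ?case using Diff1_maps assms(1,2) by (simp del: mem_sphere_0)
qed (use assms(3) in simp)

text \<open>Forward minimality provides a word into the target ball from every point.  Backward minimality
  provides a word from every open set to any given point; a word in the inverses is turned around
  for this.\<close>

lemma circle_common_visiting_word:
  assumes f1: "f1 \<in> Diff1" "orientation_preserving f1" and f2: "f2 \<in> Diff1" "orientation_preserving f2"
    and fwd: "contracting_pair f1 f2 \<mu> r K"
    and bwd: "contracting_pair (circle_inv f1) (circle_inv f2) \<mu>' r' K'"
    and "y \<in> S1" "e > 0"
  obtains w where "set w \<subseteq> {1, 2}"
    "\<And>z. z \<in> S1 \<Longrightarrow> \<exists>k\<le>length w. dist (fold (choose_map f1 f2) (take k w) z) y < e"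
proof -
  let ?f = "choose_map f1 f2"
  obtain F1 where F1: "\<And>t. (F1 has_real_derivative circle_deriv f1 (cis t)) (at t)"
    "\<And>t. f1 (cis t) = cis (F1 t)" "strict_mono F1" "\<And>t. F1 (t + 2 * pi) = F1 t + 2 * pi"
    by (rule orientation_preserving_lift[OF f1]) (rule that)
  obtain F2 where F2: "\<And>t. (F2 has_real_derivative circle_deriv f2 (cis t)) (at t)"
    "\<And>t. f2 (cis t) = cis (F2 t)" "strict_mono F2" "\<And>t. F2 (t + 2 * pi) = F2 t + 2 * pi"
    by (rule orientation_preserving_lift[OF f2]) (rule that)
  let ?F = "choose_map F1 F2"
  interpret lifted_pair ?F
  proof
    have "continuous_on UNIV F1" "continuous_on UNIV F2"
      using F1(1) F2(1) by (meson DERIV_isCont continuous_at_imp_continuous_on)+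
    then show "continuous_on UNIV (?F i)" for i by simp
  qed (use F1(3,4) F2(3,4) in auto)
  have lift: "fold ?f w (cis t) = cis (fold ?F w t)" for w t
    by (induction w arbitrary: t) (auto simp: F1(2) F2(2))
  have maps: "f1 ` S1 \<subseteq> S1" "f2 ` S1 \<subseteq> S1"
    using Diff1_maps f1(1) f2(1) by blast+
  have cis_2pi: "cis (t + 2 * pi) = cis t" for t
    using cis_eq_iff[of "t + 2 * pi" t] by (auto intro: exI[of _ 1])
  define U where "U = {t. dist (cis t) y < e}"
  have "continuous_on UNIV cis"
    using has_vector_derivative_continuous[OF has_vector_derivative_cis]
    by (simp add: continuous_at_imp_continuous_on)
  then have open_U: "open U"
    unfolding U_def by (intro open_Collect_less continuous_intros)
  have U_periodic: "t + 2 * pi \<in> U \<longleftrightarrow> t \<in> U" for t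
    by (simp add: U_def cis_2pi)
  have forward: "\<exists>w. set w \<subseteq> {1, 2} \<and> fold ?F w x \<in> U" for x
  proof -
    obtain h where h: "h \<in> IFS f1 f2" "dist (h (cis x)) y < e"
      using contracting_pair.orbit_approaches[OF fwd, of "cis x" y e] \<open>y \<in> S1\<close> \<open>e > 0\<close> by auto
    obtain w where "set w \<subseteq> {1, 2}" "\<forall>z\<in>S1. h z = fold ?f w z"
      using IFS_word[OF maps h(1)] by blast
    then show ?thesis
      using h(2) lift[of w x] by (intro exI[of _ w]) (auto simp: U_def)
  qed
  have backward: "\<exists>w t. set w \<subseteq> {1, 2} \<and> t \<in> V \<and> fold ?F w t = x"
    if V: "open V" "V \<noteq> {}" "\<And>t. t + 2 * pi \<in> V \<longleftrightarrow> t \<in> V" for V x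
  proof -
    obtain t0 d where t0: "d > 0" "ball t0 d \<subseteq> V"
      using V(1,2) by (metis all_not_in_conv open_contains_ball)
    obtain h where h: "h \<in> IFS (circle_inv f1) (circle_inv f2)" "dist (h (cis x)) (cis t0) < d / 4"
      using contracting_pair.orbit_approaches[OF bwd, of "cis x" "cis t0" "d / 4"] t0(1) by auto
    obtain k where k: "k \<in> IFS f1 f2" "\<forall>z\<in>S1. k (h z) = z \<and> h (k z) = z"
      using IFS_inverse[OF f1(1) f2(1) h(1)] by blast
    have "h (cis x) \<in> S1"
      using contracting_pair.IFS_maps[OF bwd h(1), of "cis x"] by simp
    then obtain t where t: "h (cis x) = cis t" "\<bar>t - t0\<bar> \<le> 4 * dist (h (cis x)) (cis t0)"
      using arc_le_chord by blast
    then have "t \<in> V"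
      using h(2) t0(2) by (auto simp: subset_iff dist_real_def abs_minus_commute)
    obtain w where w: "set w \<subseteq> {1, 2}" "\<forall>z\<in>S1. k z = fold ?f w z"
      using IFS_word[OF maps k(1)] by blast
    have "cis (fold ?F w t) = k (h (cis x))"
      using w(2) lift[of w t] by (simp add: t(1))
    also have "\<dots> = cis x"
      using k(2) by simp
    finally obtain n :: int where n: "fold ?F w t = x + of_int n * (2 * pi)"
      unfolding cis_eq_iff by blast
    have "fold ?F w (t + of_int (- n) * (2 * pi)) = x"
      unfolding fold_periodic n by simp
    moreover have "t + of_int (- n) * (2 * pi) \<in> V"
      using \<open>t \<in> V\<close> translation_invariant_set_int[of "2 * pi" V, OF V(3)] by blast
    ultimately show ?thesis
      using w(1) by blast
  qed
  obtain w where w: "set w \<subseteq> {1, 2}" "\<And>x. \<exists>k\<le>length w. fold ?F (take k w) x \<in> U"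
  proof (rule common_visiting_word[OF open_U U_periodic forward])
    fix V x assume "open V" "V \<noteq> {}" "\<And>t. t + 2 * pi \<in> V \<longleftrightarrow> t \<in> V"
    then show "\<exists>w t. set w \<subseteq> {1, 2} \<and> t \<in> V \<and> fold ?F w t = x"
      by (rule backward)
  qed (rule that)
  have "\<exists>k\<le>length w. dist (fold ?f (take k w) z) y < e" if "z \<in> S1" for z
  proof -
    obtain t where t: "z = cis t" using circle_eq_cis[OF \<open>z \<in> S1\<close>] by blast
    obtain k where "k \<le> length w" "fold ?F (take k w) t \<in> U" using w(2) by blast
    then show ?thesis
      unfolding t lift U_def by blast
  qed
  with w(1) show thesis by (rule that)
qed

lemma branch_orbit_dense:
  assumes f1: "f1 \<in> Diff1" "orientation_preserving f1" and f2: "f2 \<in> Diff1" "orientation_preserving f2"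
    and "contracting_pair f1 f2 \<mu> r K"
    and "contracting_pair (circle_inv f1) (circle_inv f2) \<mu>' r' K'"
    and x: "x \<in> S1" and \<omega>: "dense_shift_orbit \<omega>"
  shows "closure (branch_orbit f1 f2 \<omega> x) = S1"
proof -
  have "dense_in_circle (branch_orbit f1 f2 \<omega> x)"
  proof (rule dense_in_circleI)
    show "branch_orbit f1 f2 \<omega> x \<subseteq> S1"
      using branch_on_circle[OF f1(1) f2(1) x] by (auto simp: branch_orbit_def simp del: mem_sphere_0)
    fix y :: complex and e :: real assume "y \<in> S1" "e > 0"
    then obtain w where w: "set w \<subseteq> {1, 2}"
      "\<And>z. z \<in> S1 \<Longrightarrow> \<exists>k\<le>length w. dist (fold (choose_map f1 f2) (take k w) z) y < e"
      by (rule circle_common_visiting_word[OF assms(1-6)]) (rule that)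
    \<comment> \<open>The extra letter in front of w ensures that the visit happens at a positive time.\<close>
    obtain n where n: "\<And>j. j < length (1 # w) \<Longrightarrow> \<omega> (n + j) = (1 # w) ! j"
      using dense_shift_orbit_contains_word[OF \<omega>, of "1 # w"] w(1) by auto
    have tail: "\<omega> (Suc n + j) = w ! j" if "j < length w" for j
      using n[of "Suc j"] that by simp
    obtain k where k: "k \<le> length w"
      "dist (fold (choose_map f1 f2) (take k w) (branch f1 f2 \<omega> (Suc n) x)) y < e"
      using w(2)[OF branch_on_circle[OF f1(1) f2(1) x]] by blast
    then have "dist (branch f1 f2 \<omega> (Suc n + k) x) y < e"
      using branch_follows_word[of w \<omega> "Suc n" k] tail by metis
    then show "\<exists>z\<in>branch_orbit f1 f2 \<omega> x. dist z y < e"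
      unfolding branch_orbit_def
      by (intro bexI[of _ "branch f1 f2 \<omega> (Suc n + k) x"] CollectI exI[of _ "Suc n + k"]) auto
  qed
  then show ?thesis by (simp add: dense_in_circle_def)
qed

lemma circle_deriv_rotation: "z \<in> S1 \<Longrightarrow> circle_deriv (rotation \<alpha>) z = 1"
proof -
  assume "z \<in> S1"
  then obtain t where t: "z = cis t" using circle_eq_cis by blast
  have "((\<lambda>t. t + 2 * pi * \<alpha>) has_real_derivative 1) (at t)"
    by (auto intro!: derivative_eq_intros)
  then show ?thesis
    unfolding t by (rule circle_deriv_eq_lift_deriv) (simp add: rotation_def cis_mult add.commute)
qed

lemma orientation_preserving_lower_bound:
  assumes f: "f \<in> Diff1" and op: "orientation_preserving f"
  obtains m where "m > 0" "\<And>z. z \<in> S1 \<Longrightarrow> m \<le> circle_deriv f z"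
proof -
  have "continuous_on {-pi..pi} (\<lambda>t. circle_deriv f (cis t))"
    using Diff1_velocity(2)[OF f] continuous_on_subset by blast
  then have "\<exists>t0\<in>{-pi..pi}. \<forall>t\<in>{-pi..pi}. circle_deriv f (cis t0) \<le> circle_deriv f (cis t)"
    by (intro continuous_attains_inf) auto
  then obtain t0 where t0: "\<And>t. t \<in> {-pi..pi} \<Longrightarrow> circle_deriv f (cis t0) \<le> circle_deriv f (cis t)"
    by blast
  have "circle_deriv f (cis t0) \<le> circle_deriv f z" if "z \<in> S1" for z
  proof -
    have "Arg z \<in> {-pi..pi}" using Arg_bounded[of z] by auto
    from t0[OF this] show ?thesis by (simp only: circle_eq_cis[OF that, symmetric])
  qed
  moreover have "circle_deriv f (cis t0) > 0"
    using op by (simp add: orientation_preserving_def)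
  ultimately show thesis by (rule that[rotated])
qed

lemma C1_near_orientation_preserving:
  assumes "C1_near \<eta> f g" "\<eta> < m" "\<And>z. z \<in> S1 \<Longrightarrow> m \<le> circle_deriv g z"
  shows "orientation_preserving f"
  unfolding orientation_preserving_def
proof
  fix z :: complex assume z: "z \<in> S1"
  have "\<bar>circle_deriv f z - circle_deriv g z\<bar> \<le> \<eta>"
    using assms(1) z by (auto simp: C1_near_def)
  with assms(2) assms(3)[OF z] show "circle_deriv f z > 0" by linarith
qed

text \<open>The radius \<open>\<eta>\<close> also keeps \<open>f1\<close> and \<open>f2\<close> orientation-preserving, which the theorem on branches
  needs: it is less than the derivative of \<open>g1\<close>, which is 1, and than a lower bound of that of \<open>g2\<close>.\<close>

theorem theorem2:
  fixes g1 g2 :: "complex \<Rightarrow> complex"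
  assumes "g1 \<in> Diff1" and "irrational_rotation g1"
    and "g2 \<in> Diff1" and "orientation_preserving g2" and "\<not> conjugate_to_rotation g2"
  shows "\<exists>U. openin (prod_topology C1_topology C1_topology) U \<and> (g1, g2) \<in> U \<and>
    (\<forall>(f1, f2)\<in>U.
      forward_backward_minimal f1 f2 \<and>
      (\<forall>x\<in>S1. \<forall>\<omega>\<in>Sigma2. dense_shift_orbit \<omega> \<longrightarrow> closure (branch_orbit f1 f2 \<omega> x) = S1) \<and>
      dense_in_circle (periodic_points f1 f2) \<and>
      (attracting_periodic_points f1 f2 \<noteq> {} \<longrightarrow>
        dense_in_circle (attracting_periodic_points f1 f2)) \<and>
      (repelling_periodic_points f1 f2 \<noteq> {} \<longrightarrow>
        dense_in_circle (repelling_periodic_points f1 f2)))"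
proof -
  interpret C1: Metric_space Diff1 C1_dist by (rule Metric_space_C1)
  obtain \<alpha> where \<alpha>: "\<alpha> \<notin> \<rat>" "g1 = rotation \<alpha>"
    using assms(2) by (auto simp: irrational_rotation_iff)
  obtain p q where p: "p \<in> S1" "circle_deriv g2 p < 1" and q: "q \<in> S1" "circle_deriv g2 q > 1"
    using not_conjugate_imp_both_sides[OF assms(3-5)] by blast
  have "circle_deriv g2 p > 0"
    using p(1) assms(4) unfolding orientation_preserving_def by blast
  then have "\<bar>circle_deriv g2 p\<bar> < 1" "\<bar>circle_deriv g2 q\<bar> > 1"
    using p(2) q(2) by auto
  obtain \<eta>1 where \<eta>1: "\<eta>1 > 0" "\<And>f1 f2. \<lbrakk>C1_near \<eta>1 f1 (rotation \<alpha>); C1_near \<eta>1 f2 g2\<rbrakk> \<Longrightarrow>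
      \<exists>\<mu> r. contracting_pair f1 f2 \<mu> r 2"
    by (rule forward_contracting[OF \<alpha>(1) assms(3) p(1) \<open>\<bar>circle_deriv g2 p\<bar> < 1\<close>]) (rule that)
  obtain \<eta>2 where \<eta>2: "\<eta>2 > 0" "\<And>f1 f2. \<lbrakk>C1_near \<eta>2 f1 (rotation \<alpha>); C1_near \<eta>2 f2 g2\<rbrakk> \<Longrightarrow>
      \<exists>\<mu> r. contracting_pair (circle_inv f1) (circle_inv f2) \<mu> r 2"
    by (rule backward_contracting[OF \<alpha>(1) assms(3) q(1) \<open>\<bar>circle_deriv g2 q\<bar> > 1\<close>]) (rule that)
  obtain m where m: "m > 0" "\<And>z. z \<in> S1 \<Longrightarrow> m \<le> circle_deriv g2 z"
    by (rule orientation_preserving_lower_bound[OF assms(3,4)]) (rule that)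
  define \<eta> where "\<eta> = min (min \<eta>1 \<eta>2) (min (1 / 2) (m / 2))"
  have \<eta>: "\<eta> > 0" "\<eta> \<le> \<eta>1" "\<eta> \<le> \<eta>2" "\<eta> < 1" "\<eta> < m"
    using \<eta>1(1) \<eta>2(1) m(1) by (auto simp: \<eta>_def min_def)
  obtain \<delta>1 where \<delta>1: "\<delta>1 > 0" "\<And>f. \<lbrakk>f \<in> Diff1; C1_dist g1 f < \<delta>1\<rbrakk> \<Longrightarrow> C1_near \<eta> f g1"
    by (rule C1_dist_imp_near[OF assms(1) \<eta>(1)]) (rule that)
  obtain \<delta>2 where \<delta>2: "\<delta>2 > 0" "\<And>f. \<lbrakk>f \<in> Diff1; C1_dist g2 f < \<delta>2\<rbrakk> \<Longrightarrow> C1_near \<eta> f g2"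
    by (rule C1_dist_imp_near[OF assms(3) \<eta>(1)]) (rule that)
  define U where "U = C1.mball g1 \<delta>1 \<times> C1.mball g2 \<delta>2"
  have U_open: "openin (prod_topology C1_topology C1_topology) U"
    unfolding U_def C1_topology_def openin_prod_Times_iff by simp
  have g_in_U: "(g1, g2) \<in> U"
    using assms(1,3) \<delta>1(1) \<delta>2(1) by (simp add: U_def)
  have main: "forward_backward_minimal f1 f2 \<and>
      (\<forall>x\<in>S1. \<forall>\<omega>\<in>Sigma2. dense_shift_orbit \<omega> \<longrightarrow> closure (branch_orbit f1 f2 \<omega> x) = S1) \<and>
      dense_in_circle (periodic_points f1 f2) \<and>
      (attracting_periodic_points f1 f2 \<noteq> {} \<longrightarrow>
        dense_in_circle (attracting_periodic_points f1 f2)) \<and>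
      (repelling_periodic_points f1 f2 \<noteq> {} \<longrightarrow>
        dense_in_circle (repelling_periodic_points f1 f2))" if "(f1, f2) \<in> U" for f1 f2
  proof -
    have f: "f1 \<in> Diff1" "f2 \<in> Diff1" and near: "C1_near \<eta> f1 (rotation \<alpha>)" "C1_near \<eta> f2 g2"
      using that \<delta>1(2) \<delta>2(2) \<alpha>(2) by (auto simp: U_def)
    have op1: "orientation_preserving f1"
      using near(1) \<eta>(4) by (rule C1_near_orientation_preserving) (simp add: circle_deriv_rotation)
    have op2: "orientation_preserving f2"
      using near(2) \<eta>(5) m(2) by (rule C1_near_orientation_preserving)
    obtain \<mu> r where fwd: "contracting_pair f1 f2 \<mu> r 2"
      using \<eta>1(2)[OF C1_near_mono[OF near(1) \<eta>(2)] C1_near_mono[OF near(2) \<eta>(2)]] by blast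
    obtain \<mu>' r' where bwd: "contracting_pair (circle_inv f1) (circle_inv f2) \<mu>' r' 2"
      using \<eta>2(2)[OF C1_near_mono[OF near(1) \<eta>(3)] C1_near_mono[OF near(2) \<eta>(3)]] by blast
    have minimal: "forward_backward_minimal f1 f2"
      unfolding forward_backward_minimal_def
      by (intro conjI contracting_pair.minimal[OF fwd] contracting_pair.minimal[OF bwd])
    have attracting: "dense_in_circle (attracting_periodic_points f1 f2)"
      by (rule dense_attracting_periodic_points[OF f fwd])
    have periodic: "dense_in_circle (periodic_points f1 f2)"
      using attracting by (rule dense_in_circle_mono)
        (auto simp: attracting_periodic_points_def periodic_points_def)
    show ?thesis
      by (intro conjI ballI impI minimal attracting periodic
          dense_repelling_periodic_points[OF f bwd] branch_orbit_dense[OF f(1) op1 f(2) op2 fwd bwd])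
  qed
  show ?thesis
    by (intro exI[of _ U] conjI[OF U_open conjI[OF g_in_U]] ballI case_prodI2, rule main, simp)
qed

end
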